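(* Let $K$ be a field, let $k\ge 2$ be an integer, and let $a,d\in\mathbb{N}^2$ be linearly independent over $\mathbb{Q}$ such that $\{a,a+d,\ldots,a+kd\}$ is a minimal generating set of $S_{a,d,k}=\langle a,a+d,\ldots,a+kd\rangle$. Then the ring $K[S_{a,d,k}]$ is Koszul.
   Context: $\mathbb{N}$ denotes the set of non-negative integers. $\langle a_1,\ldots,a_n\rangle=\{\sum_i\lambda_i a_i\mid \lambda_i\in\mathbb{N}\}$ is the affine semigroup generated by $a_1,\ldots,a_n\in\mathbb{N}^r$. $K[S]=\bigoplus_{s\in S}K\mathbf{t}^s\subseteq K[t_1,\ldots,t_r]$ is the semigroup ring of $S$. Write $K[S_{a,d,k}]\cong K[x_1,\ldots,x_{k+1}]/I_{S_{a,d,k}}$, where $I_{S_{a,d,k}}$ is the kernel of $x_i\mapsto\mathbf{t}^{a+(i-1)d}$; this ideal is homogeneous for the standard grading $\deg x_i=1$. For a graded ideal $I$ of $K[x_1,\ldots,x_n]$, the ring $A=K[x_1,\ldots,x_n]/I$ is called Koszul if the minimal free resolution of $K$ over $A$ is linear, i.e. the nonzero entries of the matrices of the differentials are linear forms. *)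

theory Defs
  imports
    "HOL-Analysis.Cartesian_Space"
    "HOL-Algebra.QuotRing"
    "HOL-Library.Poly_Mapping"
begin

section \<open>Polynomial rings, their grading and graded ideals\<close>

text \<open>
  An exponent vector is a finitely supported function from variable indices to \<open>nat\<close>;
  the ring \<open>K[x\<^sub>1, \<dots>, x\<^sub>n]\<close> consists of the polynomials in which only variables with
  index in \<open>{1..n}\<close> occur.
\<close>

type_synonym 'k mpoly = "(nat \<Rightarrow>\<^sub>0 nat) \<Rightarrow>\<^sub>0 'k"

definition mpoly_ring :: "nat \<Rightarrow> 'k::field mpoly ring" where
  "mpoly_ring n =
     \<lparr>carrier = {f. \<forall>m \<in> Poly_Mapping.keys f. Poly_Mapping.keys m \<subseteq> {1..n}},
      mult = (*), one = 1, zero = 0, add = (+)\<rparr>"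

definition var :: "nat \<Rightarrow> 'k::field mpoly" where
  "var i = Poly_Mapping.single (Poly_Mapping.single i 1) 1"

definition mon_degree :: "(nat \<Rightarrow>\<^sub>0 nat) \<Rightarrow> nat" where
  "mon_degree m = (\<Sum>i\<in>Poly_Mapping.keys m. Poly_Mapping.lookup m i)"

text \<open>The degrees are integers, so that twists by arbitrary integers make sense; the
  components of negative degree are zero.\<close>

definition homogeneous_part :: "nat \<Rightarrow> int \<Rightarrow> 'k::field mpoly set" where
  "homogeneous_part n e =
     {f \<in> carrier (mpoly_ring n). \<forall>m \<in> Poly_Mapping.keys f. int (mon_degree m) = e}"

definition homogeneous_component :: "nat \<Rightarrow> 'k::field mpoly \<Rightarrow> 'k mpoly" where
  "homogeneous_component e f =
     (\<Sum>m \<in> {m \<in> Poly_Mapping.keys f. mon_degree m = e}.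
        Poly_Mapping.single m (Poly_Mapping.lookup f m))"

definition graded_ideal :: "nat \<Rightarrow> 'k::field mpoly set \<Rightarrow> bool" where
  "graded_ideal n I \<longleftrightarrow>
     ideal I (mpoly_ring n) \<and> (\<forall>f\<in>I. \<forall>e. homogeneous_component e f \<in> I)"


section \<open>Minimal graded free resolutions of the residue field and Koszul algebras\<close>

text \<open>For a graded ideal \<open>I\<close> of \<open>K[x\<^sub>1, \<dots>, x\<^sub>n]\<close>, the graded ring
  \<open>A = K[x\<^sub>1, \<dots>, x\<^sub>n]/I\<close>, its component of degree \<open>e\<close>, and its ideal
  \<open>\<mm> = (x\<^sub>1, \<dots>, x\<^sub>n)A\<close>. If \<open>I\<close> is proper, then \<open>A/\<mm> = K\<close>.\<close>

definition quot_ring :: "nat \<Rightarrow> 'k::field mpoly set \<Rightarrow> 'k mpoly set ring" where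
  "quot_ring n I = mpoly_ring n Quot I"

definition quot_part :: "nat \<Rightarrow> 'k::field mpoly set \<Rightarrow> int \<Rightarrow> 'k mpoly set set" where
  "quot_part n I e = (\<lambda>f. I +>\<^bsub>mpoly_ring n\<^esub> f) ` homogeneous_part n e"

definition quot_max_ideal :: "nat \<Rightarrow> 'k::field mpoly set \<Rightarrow> 'k mpoly set set" where
  "quot_max_ideal n I =
     Idl\<^bsub>quot_ring n I\<^esub> ((\<lambda>i. I +>\<^bsub>mpoly_ring n\<^esub> var i) ` {1..n})"

text \<open>The free module \<open>A\<^sup>c\<close>, and the map \<open>A\<^sup>c \<rightarrow> A\<^sup>r\<close> given by an
  \<open>r \<times> c\<close> matrix acting on column vectors.\<close>

definition free_module :: "('a, 'b) ring_scheme \<Rightarrow> nat \<Rightarrow> (nat \<Rightarrow> 'a) set" where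
  "free_module A c = {..<c} \<rightarrow>\<^sub>E carrier A"

definition mat_map ::
  "('a, 'b) ring_scheme \<Rightarrow> nat \<Rightarrow> nat \<Rightarrow> (nat \<Rightarrow> nat \<Rightarrow> 'a) \<Rightarrow> (nat \<Rightarrow> 'a) \<Rightarrow> nat \<Rightarrow> 'a" where
  "mat_map A r c M v = (\<lambda>p\<in>{..<r}. \<Oplus>\<^bsub>A\<^esub>q\<in>{..<c}. M p q \<otimes>\<^bsub>A\<^esub> v q)"

text \<open>
  The data \<open>b\<close>, \<open>s\<close>, \<open>M\<close> describe the complex of graded modules
  \<open>\<dots> \<rightarrow> F\<^sub>2 \<rightarrow> F\<^sub>1 \<rightarrow> F\<^sub>0 = A \<rightarrow> K \<rightarrow> 0\<close> with
  \<open>F\<^sub>i = \<Oplus>\<^bsub>p < b i\<^esub> A(- s i p)\<close>, in which \<open>F\<^bsub>i+1\<^esub> \<rightarrow> F\<^sub>i\<close> is given by the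
  matrix \<open>M (i + 1)\<close> and \<open>A \<rightarrow> K = A/\<mm>\<close> is the canonical projection. The differentials are
  homogeneous of degree 0 (first condition) and the complex is exact at \<open>F\<^sub>0\<close> (second condition)
  and at every \<open>F\<^bsub>i+1\<^esub>\<close> (third condition). Taking \<open>F\<^sub>0 = A\<close> is no restriction for
  minimal resolutions, because \<open>K\<close> is generated by one element of degree 0.
\<close>

definition graded_free_resolution ::
  "nat \<Rightarrow> 'k::field mpoly set \<Rightarrow> (nat \<Rightarrow> nat) \<Rightarrow> (nat \<Rightarrow> nat \<Rightarrow> int) \<Rightarrow>
   (nat \<Rightarrow> nat \<Rightarrow> nat \<Rightarrow> 'k mpoly set) \<Rightarrow> bool" where
  "graded_free_resolution n I b s M \<longleftrightarrow>
     (let A = quot_ring n I in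
      b 0 = 1 \<and> s 0 0 = 0 \<and>
      (\<forall>i. \<forall>p < b i. \<forall>q < b (Suc i).
         M (Suc i) p q \<in> quot_part n I (s (Suc i) q - s i p)) \<and>
      mat_map A (b 0) (b 1) (M 1) ` free_module A (b 1) =
        {v \<in> free_module A (b 0). v 0 \<in> quot_max_ideal n I} \<and>
      (\<forall>i. mat_map A (b (Suc i)) (b (Suc (Suc i))) (M (Suc (Suc i))) `
              free_module A (b (Suc (Suc i))) =
            {v \<in> free_module A (b (Suc i)).
               mat_map A (b i) (b (Suc i)) (M (Suc i)) v = (\<lambda>p\<in>{..<b i}. \<zero>\<^bsub>A\<^esub>)}))"

definition minimal_resolution ::
  "nat \<Rightarrow> 'k::field mpoly set \<Rightarrow> (nat \<Rightarrow> nat) \<Rightarrow> (nat \<Rightarrow> nat \<Rightarrow> int) \<Rightarrow>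
   (nat \<Rightarrow> nat \<Rightarrow> nat \<Rightarrow> 'k mpoly set) \<Rightarrow> bool" where
  "minimal_resolution n I b s M \<longleftrightarrow>
     graded_free_resolution n I b s M \<and>
     (\<forall>i. \<forall>p < b i. \<forall>q < b (Suc i). M (Suc i) p q \<in> quot_max_ideal n I)"

definition linear_differentials ::
  "nat \<Rightarrow> 'k::field mpoly set \<Rightarrow> (nat \<Rightarrow> nat) \<Rightarrow>
   (nat \<Rightarrow> nat \<Rightarrow> nat \<Rightarrow> 'k mpoly set) \<Rightarrow> bool" where
  "linear_differentials n I b M \<longleftrightarrow>
     (\<forall>i. \<forall>p < b i. \<forall>q < b (Suc i).
        M (Suc i) p q \<noteq> \<zero>\<^bsub>quot_ring n I\<^esub> \<longrightarrow> M (Suc i) p q \<in> quot_part n I 1)"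

text \<open>Since the minimal graded free resolution of \<open>K\<close> over \<open>A\<close> exists and is unique up to an
  isomorphism of graded complexes, it is linear iff some minimal graded free
  resolution is linear.\<close>

definition koszul :: "nat \<Rightarrow> 'k::field mpoly set \<Rightarrow> bool" where
  "koszul n I \<longleftrightarrow>
     graded_ideal n I \<and> I \<noteq> carrier (mpoly_ring n) \<and>
     (\<exists>b s M. minimal_resolution n I b s M \<and> linear_differentials n I b M)"


section \<open>Affine semigroups, semigroup rings and toric ideals\<close>

definition affine_semigroup :: "(nat ^ 'r::finite) set \<Rightarrow> (nat ^ 'r) set" where
  "affine_semigroup G = range (\<lambda>c :: nat ^ 'r \<Rightarrow> nat. \<Sum>g\<in>G. c g *s g)"

definition minimal_generating_set :: "(nat ^ 'r::finite) set \<Rightarrow> (nat ^ 'r) set \<Rightarrow> bool" where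
  "minimal_generating_set G S \<longleftrightarrow>
     affine_semigroup G = S \<and> (\<forall>H. H \<subset> G \<longrightarrow> affine_semigroup H \<noteq> S)"

text \<open>The clause \<open>u \<noteq> v\<close> is needed because \<open>vec.independent\<close> is about sets, not families.\<close>

definition lin_indep_over_Q :: "nat ^ 'r::finite \<Rightarrow> nat ^ 'r \<Rightarrow> bool" where
  "lin_indep_over_Q u v \<longleftrightarrow>
     u \<noteq> v \<and>
     vec.independent {(\<chi> j. of_nat (u $ j)) :: rat ^ 'r, (\<chi> j. of_nat (v $ j))}"

text \<open>\<open>K[t\<^sub>1, \<dots>, t\<^sub>r]\<close> is the type \<open>(nat ^ 'r) \<Rightarrow>\<^sub>0 'k\<close>, and \<open>K[S]\<close> is the subring of the
  polynomials whose monomials have exponents in \<open>S\<close>.\<close>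

definition semigroup_ring :: "(nat ^ 'r::finite) set \<Rightarrow> ((nat ^ 'r) \<Rightarrow>\<^sub>0 'k::field) ring" where
  "semigroup_ring S =
     \<lparr>carrier = {f. Poly_Mapping.keys f \<subseteq> S}, mult = (*), one = 1, zero = 0, add = (+)\<rparr>"

text \<open>The \<open>K\<close>-algebra homomorphism with \<open>x\<^sub>i \<mapsto> t\<^bsup>g i\<^esup>\<close>.\<close>

definition toric_map ::
  "(nat \<Rightarrow> nat ^ 'r::finite) \<Rightarrow> 'k::field mpoly \<Rightarrow> ((nat ^ 'r) \<Rightarrow>\<^sub>0 'k)" where
  "toric_map g f =
     (\<Sum>m\<in>Poly_Mapping.keys f.
        Poly_Mapping.single 0 (Poly_Mapping.lookup f m) *
        (\<Prod>i\<in>Poly_Mapping.keys m. Poly_Mapping.single (g i) 1 ^ Poly_Mapping.lookup m i))"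

definition S_gens :: "nat ^ 'r::finite \<Rightarrow> nat ^ 'r \<Rightarrow> nat \<Rightarrow> (nat ^ 'r) set" where
  "S_gens a d k = (\<lambda>i. a + i *s d) ` {0..k}"

definition S_semigroup :: "nat ^ 'r::finite \<Rightarrow> nat ^ 'r \<Rightarrow> nat \<Rightarrow> (nat ^ 'r) set" where
  "S_semigroup a d k = affine_semigroup (S_gens a d k)"

definition I_S :: "nat ^ 'r::finite \<Rightarrow> nat ^ 'r \<Rightarrow> nat \<Rightarrow> 'k::field mpoly set" where
  "I_S a d k =
     a_kernel (mpoly_ring (k + 1)) (semigroup_ring (S_semigroup a d k))
       (toric_map (\<lambda>i. a + (i - 1) *s d))"

text \<open>The exponent of the image of a monomial under \<open>toric_map g\<close>.\<close>

definition toric_exp :: "(nat \<Rightarrow> nat ^ 'r::finite) \<Rightarrow> (nat \<Rightarrow>\<^sub>0 nat) \<Rightarrow> nat ^ 'r" where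
  "toric_exp g m = (\<Sum>i\<in>Poly_Mapping.keys m. Poly_Mapping.lookup m i *s g i)"

lemma toric_exp_superset:
  assumes "finite X" "Poly_Mapping.keys m \<subseteq> X"
  shows "toric_exp g m = (\<Sum>i\<in>X. Poly_Mapping.lookup m i *s g i)"
  unfolding toric_exp_def
  by (rule sum.mono_neutral_left) (use assms in \<open>auto simp: in_keys_iff vec_eq_iff\<close>)

lemma toric_exp_add: "toric_exp g (m + m') = toric_exp g m + toric_exp g m'"
proof -
  let ?X = "Poly_Mapping.keys m \<union> Poly_Mapping.keys m'"
  have "toric_exp g (m + m') = (\<Sum>i\<in>?X. Poly_Mapping.lookup (m + m') i *s g i)"
    by (rule toric_exp_superset) (use Poly_Mapping.keys_add[of m m'] in auto)
  also have "\<dots> = (\<Sum>i\<in>?X. Poly_Mapping.lookup m i *s g i) + (\<Sum>i\<in>?X. Poly_Mapping.lookup m' i *s g i)"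
    by (simp add: lookup_add vec_eq_iff sum.distrib[symmetric] algebra_simps)
  also have "\<dots> = toric_exp g m + toric_exp g m'"
    by (subst (1 2) toric_exp_superset[of ?X]) auto
  finally show ?thesis .
qed

lemma single_power_eq:
  "Poly_Mapping.single (u :: nat ^ 'r::finite) (1 :: 'k::field) ^ e = Poly_Mapping.single (e *s u) 1"
proof (induction e)
  case 0
  have "(0 :: nat) *s u = 0" by (simp add: vec_eq_iff)
  then show ?case by (simp flip: single_one)
next
  case (Suc e)
  have "Suc e *s u = u + e *s u" by (simp add: vec_eq_iff)
  then show ?case using Suc by (simp add: mult_single)
qed

lemma prod_single_eq:
  assumes "finite X"
  shows "(\<Prod>i\<in>X. Poly_Mapping.single (h i :: nat ^ 'r::finite) (1 :: 'k::field)) =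
    Poly_Mapping.single (\<Sum>i\<in>X. h i) 1"
  using assms by (induction X rule: finite_induct) (simp_all add: mult_single)

lemma toric_map_alt:
  "toric_map g f =
    (\<Sum>m\<in>Poly_Mapping.keys f. Poly_Mapping.single (toric_exp g m) (Poly_Mapping.lookup f m))"
  unfolding toric_map_def toric_exp_def
  by (simp add: single_power_eq prod_single_eq mult_single)

lemma toric_map_superset:
  assumes "finite X" "Poly_Mapping.keys f \<subseteq> X"
  shows "toric_map g f =
    (\<Sum>m\<in>X. Poly_Mapping.single (toric_exp g m) (Poly_Mapping.lookup f m))"
  unfolding toric_map_alt
  by (rule sum.mono_neutral_left) (use assms in \<open>auto simp: in_keys_iff\<close>)

lemma toric_map_zero [simp]: "toric_map g 0 = 0"
  by (simp add: toric_map_alt)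

lemma toric_map_single:
  "toric_map g (Poly_Mapping.single m c) = Poly_Mapping.single (toric_exp g m) c"
  by (subst toric_map_superset[of "{m}"]) auto

lemma toric_map_var: "toric_map g (var i) = Poly_Mapping.single (g i) 1"
proof -
  have "Suc 0 *s g i = g i" by (simp add: vec_eq_iff)
  then show ?thesis by (simp add: var_def toric_map_single toric_exp_def)
qed

lemma toric_map_add: "toric_map g (f + f') = toric_map g f + toric_map g f'"
proof -
  let ?X = "Poly_Mapping.keys f \<union> Poly_Mapping.keys f'"
  have "toric_map g (f + f') =
      (\<Sum>m\<in>?X. Poly_Mapping.single (toric_exp g m) (Poly_Mapping.lookup (f + f') m))"
    by (rule toric_map_superset) (use Poly_Mapping.keys_add[of f f'] in auto)
  also have "\<dots> = toric_map g f + toric_map g f'"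
    by (subst (1 2) toric_map_superset[of ?X]) (auto simp: lookup_add single_add sum.distrib)
  finally show ?thesis .
qed

lemma toric_map_sum: "toric_map g (\<Sum>x\<in>X. f x) = (\<Sum>x\<in>X. toric_map g (f x))"
  by (induction X rule: infinite_finite_induct) (simp_all add: toric_map_add)

lemma sum_single_keys:
  "(f :: 'a \<Rightarrow>\<^sub>0 'b::comm_monoid_add) =
    (\<Sum>m\<in>Poly_Mapping.keys f. Poly_Mapping.single m (Poly_Mapping.lookup f m))"
proof (rule poly_mapping_eqI)
  fix u
  have "(\<Sum>m\<in>Poly_Mapping.keys f. Poly_Mapping.lookup (Poly_Mapping.single m (Poly_Mapping.lookup f m)) u)
      = (\<Sum>m\<in>Poly_Mapping.keys f. if m = u then Poly_Mapping.lookup f u else 0)"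
    by (rule sum.cong) (auto simp: lookup_single when_def)
  also have "\<dots> = Poly_Mapping.lookup f u" by (simp add: in_keys_iff)
  finally show "Poly_Mapping.lookup f u = Poly_Mapping.lookup (\<Sum>m\<in>Poly_Mapping.keys f.
      Poly_Mapping.single m (Poly_Mapping.lookup f m)) u"
    by (simp add: lookup_sum)
qed

lemma toric_map_mult: "toric_map g (f * f') = toric_map g f * toric_map g f'"
proof -
  have "f * f' = (\<Sum>m\<in>Poly_Mapping.keys f. Poly_Mapping.single m (Poly_Mapping.lookup f m)) *
      (\<Sum>m\<in>Poly_Mapping.keys f'. Poly_Mapping.single m (Poly_Mapping.lookup f' m))"
    using sum_single_keys[of f] sum_single_keys[of f'] by simp
  also have "\<dots> = (\<Sum>m\<in>Poly_Mapping.keys f. \<Sum>m'\<in>Poly_Mapping.keys f'.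
      Poly_Mapping.single (m + m') (Poly_Mapping.lookup f m * Poly_Mapping.lookup f' m'))"
    by (simp add: sum_product mult_single)
  finally have "toric_map g (f * f') = (\<Sum>m\<in>Poly_Mapping.keys f. \<Sum>m'\<in>Poly_Mapping.keys f'.
      Poly_Mapping.single (toric_exp g (m + m')) (Poly_Mapping.lookup f m * Poly_Mapping.lookup f' m'))"
    by (simp add: toric_map_sum toric_map_single)
  also have "\<dots> = toric_map g f * toric_map g f'"
    by (simp add: toric_map_alt sum_product mult_single toric_exp_add)
  finally show ?thesis .
qed

lemma affine_semigroup_zero: "0 \<in> affine_semigroup G"
  unfolding affine_semigroup_def
  by (rule image_eqI[where x = "\<lambda>_. 0"]) (auto simp: vec_eq_iff)

lemma affine_semigroup_add:
  assumes "u \<in> affine_semigroup G" "v \<in> affine_semigroup G"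
  shows "u + v \<in> affine_semigroup G"
proof -
  obtain c c' where "u = (\<Sum>g\<in>G. c g *s g)" "v = (\<Sum>g\<in>G. c' g *s g)"
    using assms unfolding affine_semigroup_def by auto
  then have "u + v = (\<Sum>g\<in>G. (c g + c' g) *s g)"
    by (simp add: vec_eq_iff sum.distrib[symmetric] algebra_simps)
  then show ?thesis
    unfolding affine_semigroup_def by (intro image_eqI[where x = "\<lambda>g. c g + c' g"]) auto
qed

lemma affine_semigroup_sum:
  assumes "\<And>i. i \<in> X \<Longrightarrow> f i \<in> affine_semigroup G"
  shows "(\<Sum>i\<in>X. f i) \<in> affine_semigroup G"
  using assms
  by (induction X rule: infinite_finite_induct)
    (auto intro: affine_semigroup_add affine_semigroup_zero)

lemma affine_semigroup_smult:
  assumes "finite G" "u \<in> G"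
  shows "e *s u \<in> affine_semigroup G"
proof -
  have "e *s u = (\<Sum>g\<in>G. (if g = u then e else 0) *s g)"
  proof -
    have "(\<Sum>g\<in>G. (if g = u then e else 0) *s g) = (\<Sum>g\<in>G. if g = u then e *s u else 0)"
      by (rule sum.cong) (auto simp: vec_eq_iff)
    also have "\<dots> = e *s u" using assms by simp
    finally show ?thesis ..
  qed
  then show ?thesis
    unfolding affine_semigroup_def by (intro image_eqI[where x = "\<lambda>g. if g = u then e else 0"]) auto
qed

lemma cring_mpoly_ring: "cring (mpoly_ring n :: 'k::field mpoly ring)"
proof (rule cringI)
  show "abelian_group (mpoly_ring n :: 'k mpoly ring)"
  proof (rule abelian_groupI)
    fix f assume "f \<in> carrier (mpoly_ring n :: 'k mpoly ring)"
    then show "\<exists>h\<in>carrier (mpoly_ring n). h \<oplus>\<^bsub>mpoly_ring n\<^esub> f = \<zero>\<^bsub>mpoly_ring n\<^esub>"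
      by (intro bexI[of _ "- f"]) (auto simp: mpoly_ring_def in_keys_iff)
  qed (use Poly_Mapping.keys_add in \<open>fastforce simp: mpoly_ring_def add_ac\<close>)+
  show "comm_monoid (mpoly_ring n :: 'k mpoly ring)"
  proof (rule comm_monoidI)
    fix f h :: "'k mpoly"
    assume A: "f \<in> carrier (mpoly_ring n)" "h \<in> carrier (mpoly_ring n)"
    show "f \<otimes>\<^bsub>mpoly_ring n\<^esub> h \<in> carrier (mpoly_ring n)"
    proof -
      have "Poly_Mapping.keys m \<subseteq> {1..n}" if mem: "m \<in> Poly_Mapping.keys (f * h)" for m
      proof -
        obtain u v where "m = u + v" "u \<in> Poly_Mapping.keys f" "v \<in> Poly_Mapping.keys h"
          using mem keys_mult[of f h] by blast
        moreover from this have "Poly_Mapping.keys u \<subseteq> {1..n}" "Poly_Mapping.keys v \<subseteq> {1..n}"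
          using A by (auto simp: mpoly_ring_def)
        ultimately show ?thesis using Poly_Mapping.keys_add[of u v] by blast
      qed
      then show ?thesis by (simp add: mpoly_ring_def)
    qed
  qed (auto simp: mpoly_ring_def mult_ac)
qed (auto simp: mpoly_ring_def algebra_simps)

lemma cring_semigroup_ring:
  "cring (semigroup_ring (affine_semigroup G) :: ((nat ^ 'r::finite) \<Rightarrow>\<^sub>0 'k::field) ring)"
proof (rule cringI)
  let ?R = "semigroup_ring (affine_semigroup G) :: ((nat ^ 'r) \<Rightarrow>\<^sub>0 'k) ring"
  show "abelian_group ?R"
  proof (rule abelian_groupI)
    fix f assume "f \<in> carrier ?R"
    then show "\<exists>h\<in>carrier ?R. h \<oplus>\<^bsub>?R\<^esub> f = \<zero>\<^bsub>?R\<^esub>"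
      by (intro bexI[of _ "- f"]) (auto simp: semigroup_ring_def in_keys_iff subset_iff)
  qed (use Poly_Mapping.keys_add in \<open>fastforce simp: semigroup_ring_def add_ac\<close>)+
  show "comm_monoid ?R"
  proof (rule comm_monoidI)
    fix f h assume A: "f \<in> carrier ?R" "h \<in> carrier ?R"
    show "f \<otimes>\<^bsub>?R\<^esub> h \<in> carrier ?R"
      using A keys_mult[of f h] affine_semigroup_add[of _ G] by (fastforce simp: semigroup_ring_def)
  qed (auto simp: semigroup_ring_def mult_ac affine_semigroup_zero)
qed (auto simp: semigroup_ring_def algebra_simps)

lemma image_shift: "(\<lambda>i. a + (i - 1) *s d) ` {1..k + 1} = S_gens a d k"
proof -
  have "{1..k + 1} = Suc ` {0..k}" by (simp only: image_Suc_atLeastAtMost) simp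
  then show ?thesis by (simp only: S_gens_def image_image) simp
qed

lemma toric_map_carrier:
  assumes "f \<in> carrier (mpoly_ring n)"
  shows "Poly_Mapping.keys (toric_map g f) \<subseteq> affine_semigroup (g ` {1..n})"
proof
  fix u assume "u \<in> Poly_Mapping.keys (toric_map g f)"
  then have "(\<Sum>m\<in>Poly_Mapping.keys f. Poly_Mapping.lookup
      (Poly_Mapping.single (toric_exp g m) (Poly_Mapping.lookup f m)) u) \<noteq> 0"
    by (simp add: in_keys_iff toric_map_alt lookup_sum)
  then obtain m where m: "m \<in> Poly_Mapping.keys f" and "Poly_Mapping.lookup
      (Poly_Mapping.single (toric_exp g m) (Poly_Mapping.lookup f m)) u \<noteq> 0"
    by (rule sum.not_neutral_contains_not_neutral)
  then have u: "u = toric_exp g m" by (auto simp: lookup_single when_def split: if_splits)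
  have "Poly_Mapping.keys m \<subseteq> {1..n}" using m assms by (simp add: mpoly_ring_def)
  then show "u \<in> affine_semigroup (g ` {1..n})"
    unfolding u toric_exp_def
    by (intro affine_semigroup_sum affine_semigroup_smult) auto
qed

lemma toric_exp_surj:
  assumes "u \<in> affine_semigroup (g ` {1..n})"
  obtains m where "Poly_Mapping.keys m \<subseteq> {1..n}" "toric_exp g m = u"
proof -
  have "\<exists>m. Poly_Mapping.keys m \<subseteq> {1..n} \<and> toric_exp g m = (\<Sum>h\<in>H. c h *s h)"
    if "finite H" "H \<subseteq> g ` {1..n}" for H and c :: "nat ^ 'a \<Rightarrow> nat"
    using that
  proof (induction H rule: finite_induct)
    case empty
    show ?case by (rule exI[of _ 0]) (simp add: toric_exp_def)
  next
    case (insert h H)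
    then obtain m where m: "Poly_Mapping.keys m \<subseteq> {1..n}" "toric_exp g m = (\<Sum>h\<in>H. c h *s h)"
      by auto
    obtain i where i: "i \<in> {1..n}" "h = g i" using insert.prems by blast
    have "toric_exp g (Poly_Mapping.single i (c h)) = c h *s g i"
      by (subst toric_exp_superset[of "{i}"]) auto
    then have "toric_exp g (Poly_Mapping.single i (c h) + m) = (\<Sum>h\<in>insert h H. c h *s h)"
      using insert.hyps m i by (simp add: toric_exp_add)
    moreover have "Poly_Mapping.keys (Poly_Mapping.single i (c h)) \<subseteq> {1..n}"
      using i by simp
    then have "Poly_Mapping.keys (Poly_Mapping.single i (c h) + m) \<subseteq> {1..n}"
      using m Poly_Mapping.keys_add[of "Poly_Mapping.single i (c h)" m] by blast
    ultimately show ?case by blast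
  qed
  then show ?thesis using assms that unfolding affine_semigroup_def by blast
qed

lemma toric_map_surj:
  assumes "Poly_Mapping.keys (f :: (nat ^ 'r::finite) \<Rightarrow>\<^sub>0 'k::field) \<subseteq> affine_semigroup (g ` {1..n})"
  shows "f \<in> toric_map g ` carrier (mpoly_ring n)"
proof -
  have ex: "\<forall>u\<in>Poly_Mapping.keys f. \<exists>m. Poly_Mapping.keys m \<subseteq> {1..n} \<and> toric_exp g m = u"
  proof
    fix u assume "u \<in> Poly_Mapping.keys f"
    then have "u \<in> affine_semigroup (g ` {1..n})" using assms by (rule subsetD[rotated])
    then show "\<exists>m. Poly_Mapping.keys m \<subseteq> {1..n} \<and> toric_exp g m = u"
      by (rule toric_exp_surj) blast
  qed
  interpret P: cring "mpoly_ring n :: 'k mpoly ring" by (rule cring_mpoly_ring)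
  from bchoice[OF ex] obtain e where e: "\<And>u. u \<in> Poly_Mapping.keys f \<Longrightarrow>
      Poly_Mapping.keys (e u) \<subseteq> {1..n} \<and> toric_exp g (e u) = u"
    by blast
  let ?f = "\<Sum>u\<in>Poly_Mapping.keys f. Poly_Mapping.single (e u) (Poly_Mapping.lookup f u)"
  have "toric_map g ?f =
      (\<Sum>u\<in>Poly_Mapping.keys f. Poly_Mapping.single u (Poly_Mapping.lookup f u))"
    unfolding toric_map_sum by (rule sum.cong) (simp_all add: e toric_map_single)
  then have "toric_map g ?f = f" by (simp only: sum_single_keys[symmetric])
  moreover have "?f \<in> carrier (mpoly_ring n)"
  proof -
    have *: "Poly_Mapping.single (e u) (Poly_Mapping.lookup f u) \<in> carrier (mpoly_ring n)"
      if "u \<in> Poly_Mapping.keys f" for u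
      using e[OF that] by (simp add: mpoly_ring_def)
    have "(\<Sum>u\<in>X. h u) \<in> carrier (mpoly_ring n)"
      if "\<And>u. u \<in> X \<Longrightarrow> h u \<in> carrier (mpoly_ring n)" for X and h :: "nat ^ 'r \<Rightarrow> 'k mpoly"
      using that
    proof (induction X rule: infinite_finite_induct)
      case (insert u X)
      then have "h u \<oplus>\<^bsub>mpoly_ring n\<^esub> sum h X \<in> carrier (mpoly_ring n)"
        by (intro P.add.m_closed) auto
      moreover have "h u \<oplus>\<^bsub>mpoly_ring n\<^esub> sum h X = sum h (insert u X)"
        using insert.hyps by (simp add: mpoly_ring_def)
      ultimately show ?case by (simp only:)
    qed (auto simp: mpoly_ring_def)
    from this[of "Poly_Mapping.keys f", OF *] show ?thesis .
  qed
  ultimately show ?thesis by (rule rev_image_eqI[OF _ sym, rotated])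
qed

text \<open>The isomorphism \<open>K[x\<^sub>1, \<dots>, x\<^bsub>k+1\<^esub>]/I_S a d k \<cong> K[S]\<close>, so that \<open>koszul (k + 1) (I_S a d k)\<close>
  is the Koszul property of \<open>K[S]\<close>.\<close>

lemma I_S_presentation:
  fixes a d :: "nat ^ 'r::finite"
  shows "quot_ring (k + 1) (I_S a d k :: 'k::field mpoly set) \<simeq>
    (semigroup_ring (S_semigroup a d k) :: ((nat ^ 'r) \<Rightarrow>\<^sub>0 'k) ring)"
proof -
  let ?g = "\<lambda>i. a + (i - 1) *s d"
  let ?P = "mpoly_ring (k + 1) :: 'k mpoly ring"
  let ?R = "semigroup_ring (S_semigroup a d k) :: ((nat ^ 'r) \<Rightarrow>\<^sub>0 'k) ring"
  have S: "S_semigroup a d k = affine_semigroup (?g ` {1..k + 1})"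
    unfolding S_semigroup_def image_shift ..
  interpret P: cring ?P by (rule cring_mpoly_ring)
  interpret R: cring ?R unfolding S by (rule cring_semigroup_ring)
  have "ring_hom_ring ?P ?R (toric_map ?g)"
  proof (rule ring_hom_ringI)
    fix f assume "f \<in> carrier ?P"
    then show "toric_map ?g f \<in> carrier ?R"
      using toric_map_carrier[of f "k + 1" ?g] by (simp add: S semigroup_ring_def)
  next
    show "toric_map ?g \<one>\<^bsub>?P\<^esub> = \<one>\<^bsub>?R\<^esub>"
      using toric_map_single[of ?g 0 1]
      by (simp add: mpoly_ring_def semigroup_ring_def toric_exp_def flip: single_one)
  qed (rule P.ring_axioms R.ring_axioms |
      simp add: mpoly_ring_def semigroup_ring_def toric_map_add toric_map_mult)+
  moreover have "toric_map ?g ` carrier ?P = carrier ?R"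
    using toric_map_carrier[of _ "k + 1" ?g] toric_map_surj[of _ ?g "k + 1"]
    unfolding S by (auto simp: semigroup_ring_def)
  ultimately show ?thesis
    unfolding quot_ring_def I_S_def by (rule ring_hom_ring.FactRing_iso)
qed

end

theory Submission
  imports "HOL-Computational_Algebra.Polynomial" Defs
begin

text \<open>
  Since \<open>a\<close> and \<open>d\<close> are linearly independent, a product of \<open>j\<close> generators \<open>a + i\<^sub>1 d, \<dots>, a + i\<^sub>j d\<close>
  depends only on \<open>j\<close> and \<open>i = i\<^sub>1 + \<dots> + i\<^sub>j\<close>. So \<open>K[S]\<close> is isomorphic to the ring \<open>A\<close> spanned by the
  \<open>y\<^sup>j x\<^sup>i\<close> with \<open>i \<le> j k\<close>, the \<open>k\<close>-th Veronese ring of \<open>K[s,t]\<close> and the coordinate ring of the rational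
  normal curve of degree \<open>k\<close> (\<open>toric_map_eq_0_iff\<close>, \<open>I_S_eq_kernel\<close>). Its Koszul property is shown by
  an explicit linear resolution of \<open>K\<close>.

  For \<open>c \<le> k\<close> let \<open>V\<^sub>c\<close> be the \<open>A\<close>-module spanned by the \<open>y\<^sup>j x\<^sup>i\<close> with \<open>i \<le> j k + c\<close>. It is
  generated in degree \<open>0\<close> by \<open>1, x, \<dots>, x\<^sup>c\<close> (\<open>veronese_decompose\<close>). Its relations are
  combinations of the \<open>c\<close> obvious ones \<open>x \<cdot> x\<^sup>p = 1 \<cdot> x\<^bsup>p+1\<^esup>\<close>, in a unique way, with coefficients which
  have to lie in a copy of \<open>V\<^bsub>k-1\<^esub>\<close> shifted by one degree (\<open>syzygies_generated\<close>,
  \<open>syzygy_coordinates_unique\<close>); on sheaves on the projective line this is the sequence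
  \<open>0 \<rightarrow> O(-1)\<^sup>c \<rightarrow> O\<^bsup>c+1\<^esup> \<rightarrow> O(c) \<rightarrow> 0\<close>. Hence the first syzygy module of \<open>V\<^sub>c\<close> is the direct sum of \<open>c\<close>
  copies of \<open>V\<^bsub>k-1\<^esub>(-1)\<close>.

  The maximal ideal of \<open>A\<close> is \<open>V\<^sub>k(-1)\<close>. Its syzygy module is \<open>k\<close> copies of \<open>V\<^bsub>k-1\<^esub>(-2)\<close>, the
  next one is \<open>k (k - 1)\<close> copies of \<open>V\<^bsub>k-1\<^esub>(-3)\<close>, and so on: in every step all generators have the
  same degree, one higher than before. Composing the covers of these modules gives
  matrices whose nonzero entries are variables up to sign. Their kernels and images are
  computed in \<open>syz_kernel\<close> and \<open>syz_image\<close>, and the rest transports this through the isomorphism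
  of \<open>A\<close> with the quotient ring.
\<close>

section \<open>The coordinate ring of the rational normal curve and its linear syzygies\<close>

text \<open>
  The polynomials in \<open>x\<close> and \<open>y\<close> are encoded as polynomials in \<open>y\<close> over \<open>K[x]\<close>: \<open>hvar\<close> is the
  grading variable \<open>y\<close> and \<open>tvar\<close> the affine coordinate \<open>x\<close> of the curve, so that
  \<open>coeff F j\<close> is the homogeneous component of degree \<open>j\<close>. In degree \<open>j\<close> the Veronese ring consists
  of the dehomogenised binary forms of degree \<open>j k\<close>.
\<close>

definition tvar :: "'k::field poly poly" where "tvar = [:[:0, 1:]:]"
definition hvar :: "'k::field poly poly" where "hvar = [:0, 1:]"

definition veronese :: "nat \<Rightarrow> 'k::field poly poly set" where
  "veronese k = {F. \<forall>j. degree (coeff F j) \<le> j * k}"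

lemma tvar_neq_0 [simp]: "tvar \<noteq> 0" and hvar_neq_0 [simp]: "hvar \<noteq> 0"
  by (auto simp: tvar_def hvar_def)

lemma tvar_power: "tvar ^ q = [:monom 1 q:]"
  by (induction q) (simp_all add: tvar_def monom_Suc one_pCons)

lemma coeff_tvar_power_mult: "coeff (tvar ^ q * F) j = monom 1 q * coeff F j"
  by (simp add: tvar_power)

lemma hvar_mult: "hvar * F = pCons 0 F"
  by (simp add: hvar_def)

text \<open>
  Additive properties need to be checked only on the terms that occur in a polynomial. The proofs of
  the decomposition into generators and of the surjectivity of the parametrisation both use this,
  because on a single term the required preimage can be written down.
\<close>

lemma bipoly_additive_induct [consumes 0, case_names zero add monomial]:
  fixes F :: "'k::field poly poly"
  assumes "P 0" and "\<And>G H. P G \<Longrightarrow> P H \<Longrightarrow> P (G + H)"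
    and monomial: "\<And>i j. coeff (coeff F j) i \<noteq> 0 \<Longrightarrow> P (monom (monom (coeff (coeff F j) i) i) j)"
  shows "P F"
proof -
  have sum: "P (\<Sum>i\<in>I. G i)" if "\<And>i. i \<in> I \<Longrightarrow> P (G i)" for I :: "nat set" and G
    using that by (induction I rule: infinite_finite_induct) (auto intro: assms)
  have term': "P (monom (monom (coeff (coeff F j) i) i) j)" for i j
    using monomial[of j i] assms(1) by (cases "coeff (coeff F j) i = 0") auto
  have "F = (\<Sum>j\<le>degree F. monom (coeff F j) j)"
    by (rule poly_as_sum_of_monoms[symmetric])
  also have "\<dots> = (\<Sum>j\<le>degree F. \<Sum>i\<le>degree (coeff F j). monom (monom (coeff (coeff F j) i) i) j)"
  proof (rule sum.cong[OF refl])
    fix j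
    have "monom (coeff F j) j = monom (\<Sum>i\<le>degree (coeff F j). monom (coeff (coeff F j) i) i) j"
      by (simp only: poly_as_sum_of_monoms)
    then show "monom (coeff F j) j =
        (\<Sum>i\<le>degree (coeff F j). monom (monom (coeff (coeff F j) i) i) j)"
      by (simp only: monom_sum)
  qed
  finally have F: "F = (\<Sum>j\<le>degree F. \<Sum>i\<le>degree (coeff F j). monom (monom (coeff (coeff F j) i) i) j)" .
  show ?thesis
    by (subst F) (intro sum term')
qed

lemma veronese_0 [simp]: "0 \<in> veronese k"
  and veronese_1 [simp]: "1 \<in> veronese k"
  by (auto simp: veronese_def coeff_1)

lemma veronese_add: "F \<in> veronese k \<Longrightarrow> G \<in> veronese k \<Longrightarrow> F + G \<in> veronese k"
  by (auto simp: veronese_def intro: degree_add_le)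

lemma veronese_uminus: "F \<in> veronese k \<Longrightarrow> - F \<in> veronese k"
  by (auto simp: veronese_def)

lemma veronese_mult:
  assumes "F \<in> veronese k" "G \<in> veronese k"
  shows "F * G \<in> veronese k"
proof -
  have "degree (coeff F i * coeff G (j - i)) \<le> j * k" if "i \<le> j" for i j
  proof -
    have "degree (coeff F i * coeff G (j - i)) \<le> i * k + (j - i) * k"
      using assms unfolding veronese_def
      by (intro order.trans[OF degree_mult_le] add_mono) auto
    also have "\<dots> = j * k" using that by (simp flip: add_mult_distrib)
    finally show ?thesis .
  qed
  then show ?thesis
    by (auto simp: veronese_def coeff_mult intro!: degree_sum_le)
qed

lemma veronese_monom: "i \<le> j * k \<Longrightarrow> monom (monom c i) j \<in> veronese k"
  by (auto simp: veronese_def intro: order.trans[OF degree_monom_le])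

text \<open>
  The case \<open>c = k - 1\<close> says that \<open>V\<^bsub>k-1\<^esub>\<close>, shifted by one degree, is generated by
  \<open>y, y x, \<dots>, y x\<^bsup>k-1\<^esup>\<close>; the case \<open>c = k\<close> says that the variables generate the maximal ideal. A term
  \<open>y\<^bsup>j+1\<^esup> x\<^sup>i\<close> with \<open>i \<le> j k + c\<close> is \<open>y x\<^sup>q\<close> times an element of the ring for \<open>q = min i c\<close>.
\<close>

lemma veronese_decompose:
  fixes F :: "'k::field poly poly"
  assumes "coeff F 0 = 0" and "\<And>j. degree (coeff F (Suc j)) \<le> j * k + c"
  shows "\<exists>w. (\<forall>q. w q \<in> veronese k) \<and> F = hvar * (\<Sum>q\<le>c. tvar ^ q * w q)"
proof (induction F rule: bipoly_additive_induct)
  case zero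
  show ?case by (rule exI[of _ "\<lambda>_. 0"]) simp
next
  case (add G H)
  then obtain w w' where "\<forall>q. w q \<in> veronese k" "G = hvar * (\<Sum>q\<le>c. tvar ^ q * w q)"
    "\<forall>q. w' q \<in> veronese k" "H = hvar * (\<Sum>q\<le>c. tvar ^ q * w' q)"
    by blast
  then show ?case
    by (intro exI[of _ "\<lambda>q. w q + w' q"]) (simp add: veronese_add sum.distrib distrib_left)
next
  case (monomial i j)
  then obtain j' where j: "j = Suc j'" using assms(1) monomial by (cases j) auto
  define q where "q = min i c"
  have "i \<le> j' * k + c"
    using le_degree[OF monomial] assms(2)[of j'] j by simp
  then have w: "monom (monom e (i - q)) j' \<in> veronese k" for e :: 'k
    by (intro veronese_monom) (auto simp: q_def)
  have eq: "monom (monom e i) j = hvar * (tvar ^ q * monom (monom e (i - q)) j')" for e :: 'k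
    by (simp add: j hvar_mult monom_Suc tvar_power smult_monom mult_monom q_def)
  let ?w = "\<lambda>p. if p = q then monom (monom (coeff (coeff F j) i) (i - q)) j' else 0"
  have "(\<Sum>p\<le>c. tvar ^ p * ?w p) =
      (\<Sum>p\<le>c. if p = q then tvar ^ q * monom (monom (coeff (coeff F j) i) (i - q)) j' else 0)"
    by (rule sum.cong) auto
  also have "\<dots> = tvar ^ q * monom (monom (coeff (coeff F j) i) (i - q)) j'"
    by (simp add: q_def)
  finally show ?case
    by (intro exI[of _ ?w]) (simp add: w eq)
qed

text \<open>
  The relations between \<open>1, x, \<dots>, x\<^sup>c\<close> with coefficients in the Veronese ring. Over \<open>K[x,y]\<close> they
  are generated by the relations \<open>x \<cdot> x\<^sup>p - 1 \<cdot> x\<^bsup>p+1\<^esup> = 0\<close>, and the point is the degree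
  bound for the coefficients \<open>G p\<close>: since the \<open>f r\<close> with \<open>r \<le> p\<close> and those with \<open>r > p\<close> cancel,
  \<open>x\<^bsup>p+1\<^esup> G p\<close> equals \<open>\<Sum>r\<le>p. x\<^sup>r f r\<close>, whose component of degree \<open>j\<close> has degree
  at most \<open>j k + p\<close> in \<open>x\<close>. Hence \<open>G p\<close> has degree less than \<open>j k\<close> there, which means that it
  lies in the shifted module \<open>V\<^bsub>k-1\<^esub>\<close> and is a combination of the \<open>y x\<^sup>q\<close> with \<open>q < k\<close>.
\<close>

lemma syzygies_generated:
  fixes f :: "nat \<Rightarrow> 'k::field poly poly"
  assumes k: "k > 0" and f: "\<And>r. r \<le> c \<Longrightarrow> f r \<in> veronese k"
    and rel: "(\<Sum>r\<le>c. tvar ^ r * f r) = 0"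
  obtains G w where "\<And>p q. p < c \<Longrightarrow> w p q \<in> veronese k"
    "\<And>p. p < c \<Longrightarrow> G p = hvar * (\<Sum>q<k. tvar ^ q * w p q)"
    "\<And>r. r \<le> c \<Longrightarrow> f r = (if r < c then tvar * G r else 0) - (if 0 < r then G (r - 1) else 0)"
proof -
  \<comment> \<open>Synthetic division of \<open>\<Sum>r\<le>c. f r \<cdot> T\<^sup>r\<close>, which vanishes at \<open>T = x\<close>, by \<open>x - T\<close>.\<close>
  define G where "G p = - (\<Sum>r\<in>{p<..c}. tvar ^ (r - p - 1) * f r)" for p
  have G: "tvar ^ Suc p * G p = (\<Sum>r\<le>p. tvar ^ r * f r)" if "p \<le> c" for p
  proof -
    have "tvar ^ Suc p * (tvar ^ (r - p - 1) * f r) = tvar ^ r * f r" if "r \<in> {p<..c}" for r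
    proof -
      have "r = Suc p + (r - p - 1)" using that by simp
      then show ?thesis by (metis mult.assoc power_add)
    qed
    then have "tvar ^ Suc p * G p = - (\<Sum>r\<in>{p<..c}. tvar ^ r * f r)"
      unfolding G_def mult_minus_right sum_distrib_left neg_equal_iff_equal by (rule sum.cong[OF refl])
    moreover have "(\<Sum>r\<le>p. tvar ^ r * f r) = - (\<Sum>r\<in>{p<..c}. tvar ^ r * f r)"
    proof -
      have "(\<Sum>r\<le>c. tvar ^ r * f r) = (\<Sum>r\<le>p. tvar ^ r * f r) + (\<Sum>r\<in>{p<..c}. tvar ^ r * f r)"
        using that by (subst sum.union_disjoint[symmetric]) (auto intro!: sum.cong)
      then show ?thesis using rel by (simp only: eq_neg_iff_add_eq_0)
    qed
    ultimately show ?thesis by simp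
  qed
  have bound: "degree (coeff (G p) j) < j * k" if "p \<le> c" and nz: "coeff (G p) j \<noteq> 0" for p j
  proof -
    have "degree (monom 1 r * coeff (f r) j) \<le> p + j * k" if "r \<le> p" for r
      using f[of r] that \<open>p \<le> c\<close>
      by (intro order.trans[OF degree_mult_le] add_mono) (auto simp: veronese_def degree_monom_eq)
    then have "degree (coeff (\<Sum>r\<le>p. tvar ^ r * f r) j) \<le> p + j * k"
      by (auto simp: coeff_sum coeff_tvar_power_mult intro!: degree_sum_le)
    then have "degree (monom 1 (Suc p) * coeff (G p) j) \<le> p + j * k"
      unfolding G[OF that(1), symmetric] coeff_tvar_power_mult .
    then show "degree (coeff (G p) j) < j * k"
      using nz by (simp add: degree_mult_eq degree_monom_eq)
  qed
  have "\<exists>w. (\<forall>q. w q \<in> veronese k) \<and> G p = hvar * (\<Sum>q\<le>k - 1. tvar ^ q * w q)" if "p \<le> c" for p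
  proof (rule veronese_decompose)
    show "coeff (G p) 0 = 0" using bound[OF that, of 0] by auto
    show "degree (coeff (G p) (Suc j)) \<le> j * k + (k - 1)" for j
      using bound[OF that, of "Suc j"] k by (cases "coeff (G p) (Suc j) = 0") auto
  qed
  then have "\<forall>p\<in>{..<c}. \<exists>w. (\<forall>q. w q \<in> veronese k) \<and> G p = hvar * (\<Sum>q\<le>k - 1. tvar ^ q * w q)"
    by simp
  from bchoice[OF this] obtain w where w: "\<And>p q. p < c \<Longrightarrow> w p q \<in> veronese k"
    "\<And>p. p < c \<Longrightarrow> G p = hvar * (\<Sum>q\<le>k - 1. tvar ^ q * w p q)"
    by blast
  have "{..k - 1} = {..<k}" using k by auto
  then have w2: "G p = hvar * (\<Sum>q<k. tvar ^ q * w p q)" if "p < c" for p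
    using w(2)[of p] that by simp
  have "f r = (if r < c then tvar * G r else 0) - (if 0 < r then G (r - 1) else 0)" if "r \<le> c" for r
  proof -
    have "tvar ^ r * (tvar * G r) = tvar ^ r * (f r + (if 0 < r then G (r - 1) else 0))"
    proof (cases r)
      case 0
      then show ?thesis using G[of 0] by simp
    next
      case (Suc p)
      then have "tvar ^ r * (tvar * G r) = tvar ^ r * f r + tvar ^ Suc p * G p"
        using G[of r] G[of p] that by (simp add: mult_ac)
      then show ?thesis using Suc by (simp add: algebra_simps)
    qed
    then have "tvar * G r = f r + (if 0 < r then G (r - 1) else 0)"
      by (simp only: mult_cancel_left power_eq_0_iff tvar_neq_0 simp_thms)
    then have "f r = tvar * G r - (if 0 < r then G (r - 1) else 0)"
      by (simp only: add_diff_cancel_right')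
    moreover have "G c = 0" by (simp add: G_def)
    ultimately show ?thesis using that by (cases "r < c") simp_all
  qed
  with w(1) w2 show ?thesis by (rule that)
qed

text \<open>
  The relations \<open>x \<cdot> x\<^sup>p - 1 \<cdot> x\<^bsup>p+1\<^esup> = 0\<close> are themselves independent; so the next syzygies are only
  those between the generators of each coordinate \<open>G p\<close>.
\<close>

lemma syzygy_coordinates_unique:
  fixes G :: "nat \<Rightarrow> 'k::field poly poly"
  assumes "\<And>r. r \<le> c \<Longrightarrow> (if r < c then tvar * G r else 0) - (if 0 < r then G (r - 1) else 0) = 0"
    and "p < c"
  shows "G p = 0"
  using assms(2)
proof (induction p)
  case 0
  then show ?case using assms(1)[of 0] by simp
next
  case (Suc p)
  then show ?case using assms(1)[of "Suc p"] by simp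
qed


section \<open>Block matrices of linear syzygies\<close>

lemma sum_lessThan_mult:
  "(\<Sum>i<n * m. g i) = (\<Sum>a<n. \<Sum>b<m. g (a * m + b :: nat))"
proof -
  have "sum g {a * m..<a * m + m} = (\<Sum>b<m. g (a * m + b))" for a
    by (rule sum.reindex_bij_witness[of _ "\<lambda>b. a * m + b" "\<lambda>i. i - a * m"]) auto
  then show ?thesis by (simp flip: sum.nat_group)
qed

text \<open>
  A row index \<open>a (m + 1) + b\<close> is position \<open>b\<close> in block \<open>a\<close>.
\<close>

lemma all_lessThan_mult:
  "(\<forall>i<n * Suc m. P i) \<longleftrightarrow> (\<forall>a<n. \<forall>b\<le>m. P (a * Suc m + b :: nat))"
proof safe
  fix a b assume *: "\<forall>i<n * Suc m. P i" "a < n" "b \<le> m"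
  have "a * Suc m + b < Suc a * Suc m" using * by simp
  also have "\<dots> \<le> n * Suc m" using * by (intro mult_right_mono) auto
  finally show "P (a * Suc m + b)" using * by blast
next
  fix i assume *: "\<forall>a<n. \<forall>b\<le>m. P (a * Suc m + b)" "i < n * Suc m"
  have "i div Suc m < n" using *(2) by (rule less_mult_imp_div_less)
  moreover have "i mod Suc m \<le> m" by (simp flip: less_Suc_eq_le)
  ultimately have "P (i div Suc m * Suc m + i mod Suc m)" using * by blast
  then show "P i" by (simp only: div_mult_mod_eq)
qed

lemma mult_add_eq_iff:
  assumes "b < m" "b' < m"
  shows "a * m + b = a' * m + b' \<longleftrightarrow> a = a' \<and> b = (b' :: nat)"
proof
  assume *: "a * m + b = a' * m + b'"
  have "a = (a * m + b) div m" "a' = (a' * m + b') div m" using assms by simp_all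
  then have "a = a'" using * by simp
  then show "a = a' \<and> b = b'" using * by simp
qed simp

text \<open>
  The matrix of a direct sum of covers of the syzygies of \<open>V\<^sub>c\<close>. Column \<open>p k + q\<close> is the relation
  number \<open>p\<close> multiplied with \<open>y x\<^sup>q\<close>, where \<open>p = u c + p'\<close> is the relation \<open>p'\<close> in block \<open>u\<close>. That
  relation involves the rows \<open>p'\<close> and \<open>p' + 1\<close> of block \<open>u\<close>; as blocks have \<open>c + 1\<close> rows, these have
  the indices \<open>p + p div c\<close> and its successor. The elements \<open>e (q + 1)\<close> stand for \<open>y x\<^sup>q\<close>; they are a
  parameter because the same matrix occurs over the polynomial ring, with variables
  as entries, and over the Veronese ring.
\<close>

definition syz_entry :: "(nat \<Rightarrow> 'a::ab_group_add) \<Rightarrow> nat \<Rightarrow> nat \<Rightarrow> nat \<Rightarrow> nat \<Rightarrow> 'a" where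
  "syz_entry e k c i j =
     (let p = j div k; q = j mod k; r = p + p div c
      in if i = r then e (Suc (Suc q)) else if i = Suc r then - e (Suc q) else 0)"

abbreviation gen :: "nat \<Rightarrow> 'k::field poly poly" where
  "gen i \<equiv> hvar * tvar ^ (i - 1)"

abbreviation gen_combination :: "nat \<Rightarrow> (nat \<Rightarrow> 'k::field poly poly) \<Rightarrow> nat \<Rightarrow> 'k poly poly" where
  "gen_combination k v p \<equiv> hvar * (\<Sum>q<k. tvar ^ q * v (p * k + q))"

lemma block_row_iff:
  assumes "c > 0" "r \<le> c"
  shows "u * Suc c + r = p + p div c \<longleftrightarrow> r < c \<and> p = u * c + r"
    and "u * Suc c + r = Suc (p + p div c) \<longleftrightarrow> 0 < r \<and> p = u * c + (r - 1)"
proof -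
  define a b where "a = p div c" "b = p mod c"
  have b: "b < c" and p: "p = a * c + b" using assms by (simp_all add: a_b_def)
  have t: "p + p div c = a * Suc c + b" using a_b_def(1) p by simp
  show "u * Suc c + r = p + p div c \<longleftrightarrow> r < c \<and> p = u * c + r"
    unfolding t p using mult_add_eq_iff[of r "Suc c" b u a] mult_add_eq_iff[of b c r a u] assms b
    by auto
  show "u * Suc c + r = Suc (p + p div c) \<longleftrightarrow> 0 < r \<and> p = u * c + (r - 1)"
    unfolding t p using mult_add_eq_iff[of r "Suc c" "Suc b" u a]
      mult_add_eq_iff[of b c "r - 1" a u] assms b
    by auto
qed

text \<open>
  The matrix factors through the coordinates \<open>G\<close> of \<open>syzygies_generated\<close>: first the column blocks of
  length \<open>k\<close> are contracted to \<open>G p = \<Sum>q<k. y x\<^sup>q v\<^bsub>p k + q\<^esub>\<close>, then \<open>G\<close> is expanded to a relation.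
\<close>

lemma syz_row_sum:
  fixes v :: "nat \<Rightarrow> 'k::field poly poly"
  assumes "k > 0" "c > 0" "u < U" "r \<le> c"
  shows "(\<Sum>j<U * c * k. syz_entry gen k c (u * Suc c + r) j * v j) =
    (if r < c then tvar * gen_combination k v (u * c + r) else 0) -
    (if 0 < r then gen_combination k v (u * c + (r - 1)) else 0)"
proof -
  let ?G = "gen_combination k v"
  let ?i = "u * Suc c + r"
  have inner: "(\<Sum>q<k. syz_entry gen k c ?i (p * k + q) * v (p * k + q)) =
      (if r < c \<and> p = u * c + r then tvar * ?G p else 0) -
      (if 0 < r \<and> p = u * c + (r - 1) then ?G p else 0)" for p
  proof -
    have e: "syz_entry gen k c ?i (p * k + q) = (if r < c \<and> p = u * c + r then hvar * tvar ^ Suc q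
        else if 0 < r \<and> p = u * c + (r - 1) then - (hvar * tvar ^ q) else 0)" if "q < k" for q
      unfolding syz_entry_def Let_def block_row_iff[OF assms(2,4), symmetric] using that by simp
    have "(\<Sum>q<k. syz_entry gen k c ?i (p * k + q) * v (p * k + q)) =
      (\<Sum>q<k. (if r < c \<and> p = u * c + r then hvar * tvar ^ Suc q
        else if 0 < r \<and> p = u * c + (r - 1) then - (hvar * tvar ^ q) else 0) * v (p * k + q))"
      by (intro sum.cong refl) (simp only: e lessThan_iff)
    also have "\<dots> = (if r < c \<and> p = u * c + r then tvar * ?G p else 0) -
      (if 0 < r \<and> p = u * c + (r - 1) then ?G p else 0)"
    proof -
      have split: "(\<Sum>q<k. (if D then hvar * tvar ^ Suc q else if D' then - (hvar * tvar ^ q) else 0) * g q)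
        = (if D then tvar * (hvar * (\<Sum>q<k. tvar ^ q * g q)) else 0) -
          (if D' then hvar * (\<Sum>q<k. tvar ^ q * g q) else 0)"
        if "\<not> (D \<and> D')" for D D' and g :: "nat \<Rightarrow> 'k poly poly"
        using that by (cases D; cases D') (simp_all add: sum_distrib_left sum_negf mult_ac)
      show ?thesis by (rule split) auto
    qed
    finally show ?thesis .
  qed
  have "u * c + r < U * c" if "r < c"
  proof -
    have "u * c + r < Suc u * c" using that by simp
    also have "\<dots> \<le> U * c" using assms by (intro mult_right_mono) auto
    finally show ?thesis .
  qed
  moreover have "u * c + (r - 1) < U * c" if "0 < r"
  proof -
    have "u * c + (r - 1) < Suc u * c" using that assms by simp
    also have "\<dots> \<le> U * c" using assms by (intro mult_right_mono) auto
    finally show ?thesis .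
  qed
  ultimately show ?thesis
    unfolding sum_lessThan_mult[of _ "U * c"] inner sum_subtractf
    by (cases "r < c"; cases "0 < r") simp_all
qed

text \<open>
  The second factor of the matrix is injective, so the kernel is that of the contraction.
\<close>

lemma syz_kernel:
  fixes v :: "nat \<Rightarrow> 'k::field poly poly"
  assumes "k > 0" "c > 0"
  shows "(\<forall>i<U * Suc c. (\<Sum>j<U * c * k. syz_entry gen k c i j * v j) = 0) \<longleftrightarrow>
    (\<forall>p<U * c. gen_combination k v p = 0)"
proof
  assume L: "\<forall>i<U * Suc c. (\<Sum>j<U * c * k. syz_entry gen k c i j * v j) = 0"
  show "\<forall>p<U * c. gen_combination k v p = 0"
  proof (intro allI impI)
    fix p assume p: "p < U * c"
    define u where "u = p div c"
    have u: "u < U" using p by (simp add: u_def less_mult_imp_div_less)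
    have "gen_combination k v (u * c + p mod c) = 0"
    proof (rule syzygy_coordinates_unique[where c = c and G = "\<lambda>r. gen_combination k v (u * c + r)"])
      fix r assume r: "r \<le> c"
      then show "(if r < c then tvar * gen_combination k v (u * c + r) else 0) -
          (if 0 < r then gen_combination k v (u * c + (r - 1)) else 0) = 0"
        unfolding syz_row_sum[OF assms u r, symmetric]
        using L[unfolded all_lessThan_mult] u by blast
    qed (use assms in simp)
    then show "gen_combination k v p = 0" by (simp only: u_def div_mult_mod_eq)
  qed
next
  assume R: "\<forall>p<U * c. gen_combination k v p = 0"
  have "u * c + r < U * c" if "u < U" "r < c" for u r
  proof -
    have "u * c + r < Suc u * c" using that by simp
    also have "\<dots> \<le> U * c" using that by (intro mult_right_mono) auto
    finally show ?thesis .
  qed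
  then have R: "gen_combination k v (u * c + r) = 0" if "u < U" "r < c" for u r
    using R that by blast
  show "\<forall>i<U * Suc c. (\<Sum>j<U * c * k. syz_entry gen k c i j * v j) = 0"
    unfolding all_lessThan_mult
  proof (intro allI impI)
    fix u r assume u: "u < U" and r: "r \<le> c"
    show "(\<Sum>j<U * c * k. syz_entry gen k c (u * Suc c + r) j * v j) = 0"
      unfolding syz_row_sum[OF assms u r] using R[OF u, of r] R[OF u, of "r - 1"] r by auto
  qed
qed

text \<open>
  The image consists of all tuples that are, block by block, relations between
  \<open>1, x, \<dots>, x\<^sup>c\<close>. For \<open>c = k - 1\<close> this has the same shape as the kernel in \<open>syz_kernel\<close>, which is why
  the block matrices fit together to an exact sequence.
\<close>

lemma syz_image:
  fixes f :: "nat \<Rightarrow> 'k::field poly poly"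
  assumes "k > 0" "c > 0" and f: "\<forall>i<U * Suc c. f i \<in> veronese k"
  shows "(\<exists>w. (\<forall>j<U * c * k. w j \<in> veronese k) \<and>
      (\<forall>i<U * Suc c. f i = (\<Sum>j<U * c * k. syz_entry gen k c i j * w j))) \<longleftrightarrow>
    (\<forall>u<U. gen_combination (Suc c) f u = 0)"
proof (intro iffI allI impI)
  fix u assume u: "u < U"
  assume "\<exists>w. (\<forall>j<U * c * k. w j \<in> veronese k) \<and>
      (\<forall>i<U * Suc c. f i = (\<Sum>j<U * c * k. syz_entry gen k c i j * w j))"
  then obtain w where w: "\<forall>i<U * Suc c. f i = (\<Sum>j<U * c * k. syz_entry gen k c i j * w j)"
    by blast
  define G where "G r = gen_combination k w (u * c + r)" for r
  have fr: "f (u * Suc c + r) = (if r < c then tvar * G r else 0) - (if 0 < r then G (r - 1) else 0)"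
    if "r \<le> c" for r
  proof -
    have "f (u * Suc c + r) = (\<Sum>j<U * c * k. syz_entry gen k c (u * Suc c + r) j * w j)"
      using w[unfolded all_lessThan_mult] u that by blast
    then show ?thesis unfolding syz_row_sum[OF assms(1,2) u that] G_def .
  qed
  \<comment> \<open>The sum telescopes.\<close>
  have "(\<Sum>r<Suc d. tvar ^ r * ((if r < c then tvar * G r else 0) - (if 0 < r then G (r - 1) else 0)))
      = (if d < c then tvar ^ Suc d * G d else 0)" if "d \<le> c" for d
    using that by (induction d) (auto simp: algebra_simps)
  then have "(\<Sum>r<Suc c. tvar ^ r * ((if r < c then tvar * G r else 0) - (if 0 < r then G (r - 1) else 0))) = 0"
    by (simp del: sum.lessThan_Suc)
  moreover have "(\<Sum>r<Suc c. tvar ^ r * f (u * Suc c + r)) =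
      (\<Sum>r<Suc c. tvar ^ r * ((if r < c then tvar * G r else 0) - (if 0 < r then G (r - 1) else 0)))"
    by (intro sum.cong refl) (simp only: fr lessThan_iff less_Suc_eq_le)
  ultimately show "gen_combination (Suc c) f u = 0" by simp
next
  assume R: "\<forall>u<U. gen_combination (Suc c) f u = 0"
  have "\<exists>w. (\<forall>p<c. \<forall>q. w p q \<in> veronese k) \<and> (\<forall>r\<le>c. f (u * Suc c + r) =
      (if r < c then tvar * (hvar * (\<Sum>q<k. tvar ^ q * w r q)) else 0) -
      (if 0 < r then hvar * (\<Sum>q<k. tvar ^ q * w (r - 1) q) else 0))" if u: "u < U" for u
  proof -
    have rel: "(\<Sum>r\<le>c. tvar ^ r * f (u * Suc c + r)) = 0"
      using R u by (simp add: lessThan_Suc_atMost)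
    have f_u: "f (u * Suc c + r) \<in> veronese k" if "r \<le> c" for r
      using f[unfolded all_lessThan_mult] u that by blast
    obtain G w where "\<And>p q. p < c \<Longrightarrow> w p q \<in> veronese k"
      and G: "\<And>p. p < c \<Longrightarrow> G p = hvar * (\<Sum>q<k. tvar ^ q * w p q)"
      and "\<And>r. r \<le> c \<Longrightarrow> f (u * Suc c + r) =
        (if r < c then tvar * G r else 0) - (if 0 < r then G (r - 1) else 0)"
      by (rule syzygies_generated[of k c "\<lambda>r. f (u * Suc c + r)", OF assms(1) f_u rel];
          (assumption | (rule that; assumption)))
    then show ?thesis using G by (intro exI[of _ w]) auto
  qed
  then have "\<forall>u\<in>{..<U}. \<exists>w. (\<forall>p<c. \<forall>q. w p q \<in> veronese k) \<and> (\<forall>r\<le>c. f (u * Suc c + r) =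
      (if r < c then tvar * (hvar * (\<Sum>q<k. tvar ^ q * w r q)) else 0) -
      (if 0 < r then hvar * (\<Sum>q<k. tvar ^ q * w (r - 1) q) else 0))"
    by simp
  from bchoice[OF this] obtain w where w: "\<And>u p q. u < U \<Longrightarrow> p < c \<Longrightarrow> w u p q \<in> veronese k"
    and f_eq: "\<And>u r. u < U \<Longrightarrow> r \<le> c \<Longrightarrow> f (u * Suc c + r) =
      (if r < c then tvar * (hvar * (\<Sum>q<k. tvar ^ q * w u r q)) else 0) -
      (if 0 < r then hvar * (\<Sum>q<k. tvar ^ q * w u (r - 1) q) else 0)"
    by blast
  define v where "v j = w (j div k div c) (j div k mod c) (j mod k)" for j
  have v: "v ((u * c + p) * k + q) = w u p q" if "p < c" "q < k" for u p q
    using that by (simp add: v_def)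
  have "v j \<in> veronese k" if "j < U * c * k" for j
    unfolding v_def using that assms(2) by (intro w) (auto intro: less_mult_imp_div_less)
  moreover have "f (u * Suc c + r) = (\<Sum>j<U * c * k. syz_entry gen k c (u * Suc c + r) j * v j)"
    if u: "u < U" and r: "r \<le> c" for u r
  proof -
    have G: "gen_combination k v (u * c + p) = hvar * (\<Sum>q<k. tvar ^ q * w u p q)" if "p < c" for p
      using v[OF that] by simp
    have "r - 1 < c" if "0 < r" using that r by simp
    then show ?thesis
      unfolding syz_row_sum[OF assms(1,2) u r] f_eq[OF u r] by (simp only: G cong: if_cong)
  qed
  ultimately show "\<exists>w. (\<forall>j<U * c * k. w j \<in> veronese k) \<and>
      (\<forall>i<U * Suc c. f i = (\<Sum>j<U * c * k. syz_entry gen k c i j * w j))"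
    unfolding all_lessThan_mult by (intro exI[of _ v]) blast
qed


section \<open>The semigroup ring as a Veronese ring\<close>

definition weight :: "(nat \<Rightarrow> nat) \<Rightarrow> (nat \<Rightarrow>\<^sub>0 nat) \<Rightarrow> nat" where
  "weight w m = (\<Sum>i\<in>Poly_Mapping.keys m. Poly_Mapping.lookup m i * w i)"

lemma weight_superset:
  assumes "finite X" "Poly_Mapping.keys m \<subseteq> X"
  shows "weight w m = (\<Sum>i\<in>X. Poly_Mapping.lookup m i * w i)"
  unfolding weight_def by (rule sum.mono_neutral_left) (use assms in \<open>auto simp: in_keys_iff\<close>)

lemma weight_add: "weight w (m + m') = weight w m + weight w m'"
proof -
  let ?X = "Poly_Mapping.keys m \<union> Poly_Mapping.keys m'"
  have "weight w (m + m') = (\<Sum>i\<in>?X. Poly_Mapping.lookup (m + m') i * w i)"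
    by (rule weight_superset) (use Poly_Mapping.keys_add[of m m'] in auto)
  also have "\<dots> = weight w m + weight w m'"
    by (subst (1 2) weight_superset[of ?X]) (auto simp: lookup_add add_mult_distrib sum.distrib)
  finally show ?thesis .
qed

lemma weight_0 [simp]: "weight w 0 = 0"
  by (simp add: weight_def)

lemma weight_single [simp]: "weight w (Poly_Mapping.single i e) = e * w i"
  by (subst weight_superset[of "{i}"]) auto

lemma mon_degree_eq_weight: "mon_degree m = weight (\<lambda>_. 1) m"
  by (simp add: mon_degree_def weight_def)

abbreviation shift :: "(nat \<Rightarrow>\<^sub>0 nat) \<Rightarrow> nat" where
  "shift \<equiv> weight (\<lambda>i. i - 1)"

lemma shift_le:
  assumes "Poly_Mapping.keys m \<subseteq> {1..k + 1}"
  shows "shift m \<le> mon_degree m * k"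
  unfolding weight_def mon_degree_def sum_distrib_right
proof (intro sum_mono mult_left_mono)
  fix i assume "i \<in> Poly_Mapping.keys m"
  then have "i \<in> {1..k + 1}" using assms by blast
  then show "i - 1 \<le> k" by auto
qed simp

text \<open>
  Every \<open>i \<le> j k\<close> is a sum of \<open>j\<close> numbers between \<open>0\<close> and \<open>k\<close>.
\<close>

lemma monomial_with_degree_and_shift:
  assumes "i \<le> j * k"
  shows "\<exists>m. Poly_Mapping.keys m \<subseteq> {1..k + 1} \<and> mon_degree m = j \<and> shift m = i"
  using assms
proof (induction j arbitrary: i)
  case 0
  then show ?case by (intro exI[of _ 0]) (simp add: mon_degree_eq_weight)
next
  case (Suc j)
  define q where "q = min i k"
  have "i - q \<le> j * k" using Suc.prems by (auto simp: q_def)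
  then obtain m where m: "Poly_Mapping.keys m \<subseteq> {1..k + 1}" "mon_degree m = j" "shift m = i - q"
    using Suc.IH by blast
  have "Poly_Mapping.keys (m + Poly_Mapping.single (Suc q) (1 :: nat)) \<subseteq> {1..k + 1}"
    using m(1) Poly_Mapping.keys_add[of m "Poly_Mapping.single (Suc q) 1"] by (auto simp: q_def)
  then show ?case using m(2,3)
    by (intro exI[of _ "m + Poly_Mapping.single (Suc q) 1"])
      (auto simp: mon_degree_eq_weight weight_add q_def)
qed

text \<open>
  The parametrisation \<open>x\<^sub>i \<mapsto> y x\<^bsup>i-1\<^esup>\<close> of the cone over the rational normal curve.
\<close>

definition curve_term :: "(nat \<Rightarrow>\<^sub>0 nat) \<Rightarrow> 'k \<Rightarrow> 'k::field poly poly" where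
  "curve_term m e = monom (monom e (shift m)) (mon_degree m)"

definition curve_map :: "'k::field mpoly \<Rightarrow> 'k poly poly" where
  "curve_map f = (\<Sum>m\<in>Poly_Mapping.keys f. curve_term m (Poly_Mapping.lookup f m))"

lemma curve_term_0 [simp]: "curve_term m 0 = 0"
  by (simp add: curve_term_def)

lemma curve_term_add: "curve_term m (e + e') = curve_term m e + curve_term m e'"
  by (simp add: curve_term_def add_monom)

lemma curve_term_mult: "curve_term (m + m') (e * e') = curve_term m e * curve_term m' e'"
  by (simp add: curve_term_def mult_monom mon_degree_eq_weight weight_add)

lemma coeff_curve_term:
  "coeff (coeff (curve_term m e) j) i = (if mon_degree m = j \<and> shift m = i then e else 0)"
  by (simp add: curve_term_def)

lemma curve_map_superset:
  assumes "finite X" "Poly_Mapping.keys f \<subseteq> X"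
  shows "curve_map f = (\<Sum>m\<in>X. curve_term m (Poly_Mapping.lookup f m))"
  unfolding curve_map_def
  by (rule sum.mono_neutral_left) (use assms in \<open>auto simp: in_keys_iff\<close>)

lemma curve_map_0 [simp]: "curve_map 0 = 0"
  by (simp add: curve_map_def)

lemma curve_map_single: "curve_map (Poly_Mapping.single m e) = curve_term m e"
  by (subst curve_map_superset[of "{m}"]) auto

lemma curve_map_1 [simp]: "curve_map 1 = 1"
  using curve_map_single[of 0 1]
  by (simp add: curve_term_def mon_degree_eq_weight one_pCons monom_0)

lemma curve_map_var: "i \<ge> 1 \<Longrightarrow> curve_map (var i) = gen i"
  by (simp add: var_def curve_map_single curve_term_def mon_degree_eq_weight tvar_power hvar_def
      monom_Suc monom_0)

lemma curve_map_add: "curve_map (f + g) = curve_map f + curve_map g"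
proof -
  let ?X = "Poly_Mapping.keys f \<union> Poly_Mapping.keys g"
  have "curve_map (f + g) = (\<Sum>m\<in>?X. curve_term m (Poly_Mapping.lookup (f + g) m))"
    by (rule curve_map_superset) (use Poly_Mapping.keys_add[of f g] in auto)
  also have "\<dots> = curve_map f + curve_map g"
    by (subst (1 2) curve_map_superset[of ?X]) (auto simp: lookup_add curve_term_add sum.distrib)
  finally show ?thesis .
qed

lemma curve_map_uminus: "curve_map (- f) = - curve_map f"
  using curve_map_add[of f "- f"] by (simp add: eq_neg_iff_add_eq_0 add.commute)

lemma curve_map_sum: "curve_map (\<Sum>x\<in>X. f x) = (\<Sum>x\<in>X. curve_map (f x))"
  by (induction X rule: infinite_finite_induct) (simp_all add: curve_map_add)

lemma curve_map_mult: "curve_map (f * g) = curve_map f * curve_map g"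
proof -
  have "f * g = (\<Sum>m\<in>Poly_Mapping.keys f. Poly_Mapping.single m (Poly_Mapping.lookup f m)) *
      (\<Sum>m\<in>Poly_Mapping.keys g. Poly_Mapping.single m (Poly_Mapping.lookup g m))"
    using sum_single_keys[of f] sum_single_keys[of g] by simp
  then have "curve_map (f * g) = (\<Sum>m\<in>Poly_Mapping.keys f. \<Sum>m'\<in>Poly_Mapping.keys g.
      curve_term (m + m') (Poly_Mapping.lookup f m * Poly_Mapping.lookup g m'))"
    by (simp add: sum_product mult_single curve_map_sum curve_map_single)
  also have "\<dots> = curve_map f * curve_map g"
    by (simp add: curve_map_def sum_product curve_term_mult)
  finally show ?thesis .
qed

lemma curve_map_in_veronese:
  assumes "f \<in> carrier (mpoly_ring (k + 1))"
  shows "curve_map f \<in> veronese k"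
proof -
  have sum: "(\<Sum>m\<in>X. g m) \<in> veronese k" if "\<And>m. m \<in> X \<Longrightarrow> g m \<in> veronese k"
    for X :: "(nat \<Rightarrow>\<^sub>0 nat) set" and g :: "(nat \<Rightarrow>\<^sub>0 nat) \<Rightarrow> 'a poly poly"
    using that by (induction X rule: infinite_finite_induct) (auto intro: veronese_add)
  show ?thesis
    unfolding curve_map_def curve_term_def
    using assms by (intro sum veronese_monom shift_le) (auto simp: mpoly_ring_def)
qed

lemma curve_map_surj:
  assumes "F \<in> veronese k"
  shows "\<exists>f\<in>carrier (mpoly_ring (k + 1)). curve_map f = F"
proof (induction F rule: bipoly_additive_induct)
  case zero
  show ?case by (rule bexI[of _ 0]) (auto simp: mpoly_ring_def)
next
  case (add G H)
  then obtain g h where gh: "g \<in> carrier (mpoly_ring (k + 1))" "curve_map g = G"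
    "h \<in> carrier (mpoly_ring (k + 1))" "curve_map h = H" by blast
  interpret P: cring "mpoly_ring (k + 1) :: 'a mpoly ring" by (rule cring_mpoly_ring)
  have "g + h \<in> carrier (mpoly_ring (k + 1))"
    using P.a_closed[OF gh(1,3)] by (simp add: mpoly_ring_def)
  then show ?case using gh by (intro bexI[of _ "g + h"]) (simp_all add: curve_map_add)
next
  case (monomial i j)
  have "i \<le> j * k"
    using le_degree[OF monomial] assms by (auto simp: veronese_def intro: order.trans)
  then obtain m where "Poly_Mapping.keys m \<subseteq> {1..k + 1}" "mon_degree m = j" "shift m = i"
    using monomial_with_degree_and_shift by blast
  then show ?case
    by (intro bexI[of _ "Poly_Mapping.single m (coeff (coeff F j) i)"])
      (auto simp: curve_map_single curve_term_def mpoly_ring_def)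
qed

definition veronese_ring :: "nat \<Rightarrow> 'k::field poly poly ring" where
  "veronese_ring k = \<lparr>carrier = veronese k, mult = (*), one = 1, zero = 0, add = (+)\<rparr>"

lemma cring_veronese_ring: "cring (veronese_ring k :: 'k::field poly poly ring)"
proof (rule cringI)
  show "abelian_group (veronese_ring k :: 'k poly poly ring)"
  proof (rule abelian_groupI)
    fix F assume "F \<in> carrier (veronese_ring k :: 'k poly poly ring)"
    then show "\<exists>G\<in>carrier (veronese_ring k). G \<oplus>\<^bsub>veronese_ring k\<^esub> F = \<zero>\<^bsub>veronese_ring k\<^esub>"
      by (intro bexI[of _ "- F"]) (auto simp: veronese_ring_def veronese_uminus)
  qed (auto simp: veronese_ring_def add_ac veronese_add)
  show "comm_monoid (veronese_ring k :: 'k poly poly ring)"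
    by (rule comm_monoidI) (auto simp: veronese_ring_def mult_ac veronese_mult)
qed (auto simp: veronese_ring_def algebra_simps)

lemma toric_exp_eq:
  "toric_exp (\<lambda>i. a + w i *s d) m = mon_degree m *s a + weight w m *s d"
  by (simp add: vec_eq_iff toric_exp_def mon_degree_def weight_def sum_distrib_right
      sum.distrib distrib_left mult.assoc)

lemma lin_indep_over_Q_combination_eq:
  assumes indep: "lin_indep_over_Q a d" and eq: "j *s a + i *s d = j' *s a + i' *s d"
  shows "j = j' \<and> i = i'"
proof -
  define u v :: "rat ^ 'a" where "u = (\<chi> l. of_nat (a $ l))" "v = (\<chi> l. of_nat (d $ l))"
  have "\<not> (\<forall>l. a $ l = d $ l)" using indep by (auto simp: lin_indep_over_Q_def vec_eq_iff)
  then have uv: "u \<noteq> v" by (auto simp: u_v_def vec_eq_iff)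
  have ind: "vec.independent {u, v}" using indep by (simp add: lin_indep_over_Q_def u_v_def)
  let ?c = "\<lambda>x. if x = u then of_nat j - of_nat j' else of_nat i - of_nat i' :: rat"
  have "of_nat (j * a $ l + i * d $ l) = (of_nat (j' * a $ l + i' * d $ l) :: rat)" for l
    using eq by (simp add: vec_eq_iff)
  then have "(of_nat j - of_nat j') *s u + (of_nat i - of_nat i') *s v = 0"
    by (simp add: vec_eq_iff u_v_def algebra_simps)
  then have "(\<Sum>x\<in>{u, v}. ?c x *s x) = 0"
    using uv by simp
  then have c: "?c x = 0" if "x \<in> {u, v}" for x
    using vec.independentD[OF ind, of "{u, v}" ?c x] that by simp
  have "?c u = 0" "?c v = 0" by (rule c, simp)+
  then show ?thesis using uv by simp
qed

text \<open>
  A monomial of degree \<open>j\<close> and shift \<open>i\<close> has toric exponent \<open>j a + i d\<close>. By linear independence this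
  exponent determines \<open>(j, i)\<close>, so both maps identify the same monomials, and a polynomial is
  in the kernel of either iff its coefficients add up to \<open>0\<close> over each class.
\<close>

lemma toric_map_eq_0_iff:
  assumes "lin_indep_over_Q a d"
  shows "toric_map (\<lambda>i. a + (i - 1) *s d) f = 0 \<longleftrightarrow> curve_map f = 0"
proof -
  let ?e = "toric_exp (\<lambda>i. a + (i - 1) *s d)"
  have toric: "Poly_Mapping.lookup (toric_map (\<lambda>i. a + (i - 1) *s d) f) u =
      (\<Sum>m\<in>Poly_Mapping.keys f. if ?e m = u then Poly_Mapping.lookup f m else 0)" for u
    by (simp add: toric_map_alt lookup_sum lookup_single when_def)
  have curve: "coeff (coeff (curve_map f) j) i = (\<Sum>m\<in>Poly_Mapping.keys f.
      if ?e m = j *s a + i *s d then Poly_Mapping.lookup f m else 0)" for i j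
    unfolding toric_exp_eq curve_map_def coeff_sum coeff_curve_term
    using lin_indep_over_Q_combination_eq[OF assms] by (intro sum.cong refl if_cong) auto
  show ?thesis
  proof
    assume "toric_map (\<lambda>i. a + (i - 1) *s d) f = 0"
    then show "curve_map f = 0"
      by (simp del: One_nat_def add: poly_eq_iff curve toric[symmetric])
  next
    assume 0: "curve_map f = 0"
    show "toric_map (\<lambda>i. a + (i - 1) *s d) f = 0"
    proof (rule poly_mapping_eqI)
      fix u
      show "Poly_Mapping.lookup (toric_map (\<lambda>i. a + (i - 1) *s d) f) u = Poly_Mapping.lookup 0 u"
      proof (cases "u \<in> range ?e")
        case True
        then obtain j i where "u = j *s a + i *s d" by (auto simp: toric_exp_eq)
        then show ?thesis using curve[of j i] 0 by (simp del: One_nat_def add: toric)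
      next
        case False
        then have "(\<Sum>m\<in>Poly_Mapping.keys f. if ?e m = u then Poly_Mapping.lookup f m else 0) = 0"
          by (intro sum.neutral) auto
        then show ?thesis by (simp del: One_nat_def add: toric)
      qed
    qed
  qed
qed

lemma I_S_eq_kernel:
  assumes "lin_indep_over_Q a d"
  shows "I_S a d k = a_kernel (mpoly_ring (k + 1)) (veronese_ring k) curve_map"
  by (simp del: One_nat_def add: I_S_def a_kernel_def' semigroup_ring_def veronese_ring_def
      toric_map_eq_0_iff[OF assms])

lemma ring_hom_curve_map: "ring_hom_ring (mpoly_ring (k + 1)) (veronese_ring k) curve_map"
proof -
  interpret P: cring "mpoly_ring (k + 1)" by (rule cring_mpoly_ring)
  interpret V: cring "veronese_ring k" by (rule cring_veronese_ring)
  show ?thesis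
    by (rule ring_hom_ringI; (rule P.ring_axioms V.ring_axioms)?)
      (use curve_map_in_veronese in
        \<open>auto simp: mpoly_ring_def veronese_ring_def curve_map_add curve_map_mult\<close>)
qed

lemma curve_map_homogeneous_component:
  "curve_map (homogeneous_component e f) = monom (coeff (curve_map f) e) e"
proof -
  have "curve_map (homogeneous_component e f) =
      (\<Sum>m\<in>{m \<in> Poly_Mapping.keys f. mon_degree m = e}. curve_term m (Poly_Mapping.lookup f m))"
    by (simp add: homogeneous_component_def curve_map_sum curve_map_single)
  also have "\<dots> = (\<Sum>m\<in>Poly_Mapping.keys f.
      if mon_degree m = e then curve_term m (Poly_Mapping.lookup f m) else 0)"
    by (rule sum.mono_neutral_cong_left) auto
  also have "\<dots> = monom (coeff (curve_map f) e) e"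
    unfolding curve_map_def coeff_sum monom_sum
    by (rule sum.cong) (auto simp: curve_term_def)
  finally show ?thesis .
qed

lemma graded_ideal_kernel:
  "graded_ideal (k + 1) (a_kernel (mpoly_ring (k + 1)) (veronese_ring k) curve_map)"
  unfolding graded_ideal_def
proof (intro conjI ballI allI)
  show "ideal (a_kernel (mpoly_ring (k + 1)) (veronese_ring k) curve_map) (mpoly_ring (k + 1))"
    by (rule ring_hom_ring.kernel_is_ideal[OF ring_hom_curve_map])
next
  fix f e
  assume f: "f \<in> a_kernel (mpoly_ring (k + 1)) (veronese_ring k) curve_map"
  have "Poly_Mapping.keys (homogeneous_component e f) \<subseteq> Poly_Mapping.keys f"
    unfolding homogeneous_component_def
    by (rule order.trans[OF keys_sum]) (auto split: if_splits)
  then show "homogeneous_component e f \<in> a_kernel (mpoly_ring (k + 1)) (veronese_ring k) curve_map"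
    using f curve_map_homogeneous_component[of e f]
    by (auto simp: a_kernel_def' veronese_ring_def mpoly_ring_def)
qed


section \<open>Matrices over a ring isomorphic to the Veronese ring\<close>

text \<open>
  Rings with carrier are compared with the type-class ring of polynomials through \<open>\<psi>\<close>. The lemmas
  below reduce images and kernels of matrices over such a ring to identities and existence
  statements in the Veronese ring.
\<close>

locale veronese_presentation = cring A for A (structure) +
  fixes k :: nat and \<psi> :: "'a \<Rightarrow> 'k::field poly poly"
  assumes iso: "\<psi> \<in> ring_iso A (veronese_ring k)"
begin

lemma bij_psi: "bij_betw \<psi> (carrier A) (veronese k)"
  using iso by (simp add: ring_iso_def veronese_ring_def)

lemma psi_hom: "\<psi> \<in> ring_hom A (veronese_ring k)"
  using iso by (simp add: ring_iso_def)

lemma psi_closed [simp]: "x \<in> carrier A \<Longrightarrow> \<psi> x \<in> veronese k"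
  using bij_psi by (auto simp: bij_betw_def)

lemma psi_add [simp]: "x \<in> carrier A \<Longrightarrow> y \<in> carrier A \<Longrightarrow> \<psi> (x \<oplus> y) = \<psi> x + \<psi> y"
  using ring_hom_add[OF psi_hom] by (simp add: veronese_ring_def)

lemma psi_mult [simp]: "x \<in> carrier A \<Longrightarrow> y \<in> carrier A \<Longrightarrow> \<psi> (x \<otimes> y) = \<psi> x * \<psi> y"
  using ring_hom_mult[OF psi_hom] by (simp add: veronese_ring_def)

lemma psi_zero [simp]: "\<psi> \<zero> = 0"
  by (metis add_cancel_right_right l_zero psi_add zero_closed)

lemma psi_uminus [simp]: "x \<in> carrier A \<Longrightarrow> \<psi> (\<ominus> x) = - \<psi> x"
  using psi_add[of x "\<ominus> x"] by (simp add: r_neg eq_neg_iff_add_eq_0 add.commute)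

lemma psi_inj: "x \<in> carrier A \<Longrightarrow> y \<in> carrier A \<Longrightarrow> \<psi> x = \<psi> y \<Longrightarrow> x = y"
  using bij_psi by (auto simp: bij_betw_def inj_on_def)

lemma psi_surj:
  assumes "F \<in> veronese k"
  shows "\<exists>x\<in>carrier A. \<psi> x = F"
proof -
  have "F \<in> \<psi> ` carrier A" using assms bij_psi by (simp add: bij_betw_def)
  then show ?thesis by blast
qed

lemma psi_finsum:
  assumes "finite X" "f \<in> X \<rightarrow> carrier A"
  shows "\<psi> (\<Oplus>x\<in>X. f x) = (\<Sum>x\<in>X. \<psi> (f x))"
  using assms by (induction X rule: finite_induct) (simp_all add: Pi_iff)

lemma mat_map_in_free_module:
  assumes "\<And>i j. i < r \<Longrightarrow> j < c \<Longrightarrow> M i j \<in> carrier A" and "v \<in> free_module A c"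
  shows "mat_map A r c M v \<in> free_module A r"
  unfolding mat_map_def free_module_def
  using assms by (auto simp: free_module_def intro!: finsum_closed)

lemma psi_mat_map:
  assumes "\<And>i j. i < r \<Longrightarrow> j < c \<Longrightarrow> M i j \<in> carrier A" and "v \<in> free_module A c" and "i < r"
  shows "\<psi> (mat_map A r c M v i) = (\<Sum>j<c. \<psi> (M i j) * \<psi> (v j))"
proof -
  have v: "v j \<in> carrier A" if "j < c" for j
    using assms(2) that by (auto simp: free_module_def)
  then have "\<psi> (mat_map A r c M v i) = (\<Sum>j<c. \<psi> (M i j \<otimes> v j))"
    using assms by (simp add: mat_map_def psi_finsum)
  also have "\<dots> = (\<Sum>j<c. \<psi> (M i j) * \<psi> (v j))"
    using assms v by (intro sum.cong) auto
  finally show ?thesis .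
qed

lemma free_module_eqI:
  assumes "v \<in> free_module A r" "v' \<in> free_module A r" "\<And>i. i < r \<Longrightarrow> \<psi> (v i) = \<psi> (v' i)"
  shows "v = v'"
proof (rule PiE_ext)
  show "v \<in> {..<r} \<rightarrow>\<^sub>E carrier A" "v' \<in> {..<r} \<rightarrow>\<^sub>E carrier A"
    using assms by (simp_all add: free_module_def)
  show "v i = v' i" if "i \<in> {..<r}" for i
    using that assms by (intro psi_inj) (auto simp: free_module_def)
qed

lemma mat_map_eq_zero_iff:
  assumes M: "\<And>i j. i < r \<Longrightarrow> j < c \<Longrightarrow> M i j \<in> carrier A" and v: "v \<in> free_module A c"
  shows "mat_map A r c M v = (\<lambda>i\<in>{..<r}. \<zero>) \<longleftrightarrow> (\<forall>i<r. (\<Sum>j<c. \<psi> (M i j) * \<psi> (v j)) = 0)"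
proof
  assume "mat_map A r c M v = (\<lambda>i\<in>{..<r}. \<zero>)"
  then show "\<forall>i<r. (\<Sum>j<c. \<psi> (M i j) * \<psi> (v j)) = 0"
    using psi_mat_map[of r c M v, OF M v] by simp
next
  assume 0: "\<forall>i<r. (\<Sum>j<c. \<psi> (M i j) * \<psi> (v j)) = 0"
  have "(\<lambda>i\<in>{..<r}. \<zero>) \<in> free_module A r"
    by (auto simp: free_module_def)
  with mat_map_in_free_module[of r c M v, OF M v]
  show "mat_map A r c M v = (\<lambda>i\<in>{..<r}. \<zero>)"
    by (rule free_module_eqI) (simp_all add: psi_mat_map[of r c M v, OF M v] 0)
qed

lemma mat_map_image_iff:
  assumes M: "\<And>i j. i < r \<Longrightarrow> j < c \<Longrightarrow> M i j \<in> carrier A"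
  shows "v \<in> mat_map A r c M ` free_module A c \<longleftrightarrow> v \<in> free_module A r \<and>
    (\<exists>w. (\<forall>j<c. w j \<in> veronese k) \<and> (\<forall>i<r. \<psi> (v i) = (\<Sum>j<c. \<psi> (M i j) * w j)))"
proof
  assume "v \<in> mat_map A r c M ` free_module A c"
  then obtain x where x: "x \<in> free_module A c" "v = mat_map A r c M x" by blast
  have "\<psi> (x j) \<in> veronese k" if "j < c" for j
    using x(1) that by (intro psi_closed) (auto simp: free_module_def)
  moreover have "v \<in> free_module A r"
    unfolding x(2) by (rule mat_map_in_free_module[of r c M x, OF M x(1)])
  moreover have "\<psi> (v i) = (\<Sum>j<c. \<psi> (M i j) * \<psi> (x j))" if "i < r" for i
    unfolding x(2) by (rule psi_mat_map[of r c M x, OF M x(1) that])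
  ultimately show "v \<in> free_module A r \<and>
      (\<exists>w. (\<forall>j<c. w j \<in> veronese k) \<and> (\<forall>i<r. \<psi> (v i) = (\<Sum>j<c. \<psi> (M i j) * w j)))"
    by (intro conjI exI[of _ "\<lambda>j. \<psi> (x j)"] allI impI)
next
  assume R: "v \<in> free_module A r \<and>
      (\<exists>w. (\<forall>j<c. w j \<in> veronese k) \<and> (\<forall>i<r. \<psi> (v i) = (\<Sum>j<c. \<psi> (M i j) * w j)))"
  then obtain w where w: "\<And>j. j < c \<Longrightarrow> w j \<in> veronese k"
    and v: "\<And>i. i < r \<Longrightarrow> \<psi> (v i) = (\<Sum>j<c. \<psi> (M i j) * w j)" by blast
  have "\<forall>j\<in>{..<c}. \<exists>x\<in>carrier A. \<psi> x = w j"
    using w psi_surj by simp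
  from bchoice[OF this[unfolded Bex_def]]
  obtain x where x: "\<And>j. j < c \<Longrightarrow> x j \<in> carrier A" "\<And>j. j < c \<Longrightarrow> \<psi> (x j) = w j"
    by auto
  define y where "y = (\<lambda>j\<in>{..<c}. x j)"
  have y: "y \<in> free_module A c" using x(1) by (auto simp: y_def free_module_def)
  have "(\<Sum>j<c. \<psi> (M i j) * \<psi> (y j)) = (\<Sum>j<c. \<psi> (M i j) * w j)" for i
    by (intro sum.cong) (auto simp: y_def x(2))
  then have "mat_map A r c M y = v"
    using R by (intro free_module_eqI[OF mat_map_in_free_module[of r c M y, OF M y]])
      (simp_all add: psi_mat_map[of r c M y, OF M y] v)
  then show "v \<in> mat_map A r c M ` free_module A c" using y by blast
qed

text \<open>
  The elements without component of degree \<open>0\<close>; \<open>idl_variables_eq\<close> identifies this ideal as the one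
  generated by the variables.
\<close>

lemma degree_0_ideal: "ideal {x \<in> carrier A. coeff (\<psi> x) 0 = 0} A"
proof (rule idealI)
  show "ring A" by (rule ring_axioms)
  show "subgroup {x \<in> carrier A. coeff (\<psi> x) 0 = 0} (add_monoid A)"
  proof (rule subgroup.intro)
    fix x assume "x \<in> {x \<in> carrier A. coeff (\<psi> x) 0 = 0}"
    then show "inv\<^bsub>add_monoid A\<^esub> x \<in> {x \<in> carrier A. coeff (\<psi> x) 0 = 0}"
      by (simp flip: a_inv_def)
  qed auto
qed (auto simp: coeff_mult)

end

section \<open>The linear resolution of the residue field\<close>

abbreviation width :: "nat \<Rightarrow> nat \<Rightarrow> nat" where
  "width k n \<equiv> (if n = 0 then k else k - 1)"

text \<open>
  The free module \<open>F\<^bsub>n+1\<^esub>\<close> of the resolution consists of \<open>blocks k n\<close> groups of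
  \<open>width k n + 1\<close> generators; each group covers one copy of \<open>V\<^bsub>width k n\<^esub>\<close>, and the
  kernel of that covering is \<open>width k n\<close> copies of \<open>V\<^bsub>k-1\<^esub>\<close>. This gives the recursion,
  and ranks \<open>1\<close>, \<open>k + 1\<close>, \<open>k\<^sup>2\<close>, \<open>k\<^sup>2 (k - 1)\<close>, \<open>k\<^sup>2 (k - 1)\<^sup>2\<close>, and so on.
\<close>

primrec blocks :: "nat \<Rightarrow> nat \<Rightarrow> nat" where
  "blocks k 0 = 1"
| "blocks k (Suc n) = blocks k n * width k n"

fun betti :: "nat \<Rightarrow> nat \<Rightarrow> nat" where
  "betti k 0 = 1"
| "betti k (Suc n) = blocks k n * Suc (width k n)"

text \<open>
  Polynomial representatives of the entries of the differentials: the row of all variables, then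
  the block matrices. There is no differential with index \<open>0\<close>, so its value is arbitrary.
\<close>

fun res_entry :: "nat \<Rightarrow> nat \<Rightarrow> nat \<Rightarrow> nat \<Rightarrow> 'k::field mpoly" where
  "res_entry k 0 = (\<lambda>i j. 0)"
| "res_entry k (Suc 0) = (\<lambda>i j. var (Suc j))"
| "res_entry k (Suc (Suc n)) = syz_entry var k (width k n)"

lemma curve_map_syz_entry: "curve_map (syz_entry var k c i j) = syz_entry gen k c i j"
  by (simp add: syz_entry_def Let_def curve_map_var curve_map_uminus)

lemma res_entry_cases:
  assumes "k > 0" "j < betti k (Suc n)"
  obtains q where "q \<in> {1..k + 1}"
    "res_entry k (Suc n) i j \<in> {var q, - var q, 0 :: 'k::field mpoly}"
proof (cases n)
  case 0
  show ?thesis by (rule that[of "Suc j"]) (use assms 0 in auto)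
next
  case (Suc m)
  let ?p = "j div k"
  have q: "j mod k < k" using assms by simp
  have e: "res_entry k (Suc n) i j = (if i = ?p + ?p div width k m then var (Suc (Suc (j mod k)))
      else if i = Suc (?p + ?p div width k m) then - var (Suc (j mod k)) else 0 :: 'k mpoly)"
    by (simp add: Suc syz_entry_def Let_def)
  show ?thesis
  proof (cases "i = ?p + ?p div width k m")
    case True
    show ?thesis
    proof (rule that)
      show "Suc (Suc (j mod k)) \<in> {1..k + 1}" using q by auto
      show "res_entry k (Suc n) i j \<in> {var (Suc (Suc (j mod k))), - var (Suc (Suc (j mod k))), 0 :: 'k mpoly}"
        unfolding e if_P[OF True] by simp
    qed
  next
    case False
    show ?thesis
    proof (rule that)
      show "Suc (j mod k) \<in> {1..k + 1}" using q by auto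
      show "res_entry k (Suc n) i j \<in> {var (Suc (j mod k)), - var (Suc (j mod k)), 0 :: 'k mpoly}"
        unfolding e if_not_P[OF False] by simp
    qed
  qed
qed

text \<open>
  Exactness, expressed in the Veronese ring. Both sides say that each group of generators
  carries a relation between \<open>1, x, \<dots>, x\<^sup>c\<close>, where \<open>c\<close> is \<open>k\<close> in the first module and \<open>k - 1\<close> later:
  the left side by \<open>syz_image\<close>, the right side by \<open>syz_kernel\<close>, or directly by the definition
  of the row of variables when \<open>n = 0\<close>.
\<close>

lemma res_exact:
  fixes f :: "nat \<Rightarrow> 'k::field poly poly"
  assumes "k \<ge> 2" and f: "\<forall>i<betti k (Suc n). f i \<in> veronese k"
  shows "(\<exists>w. (\<forall>j<betti k (Suc (Suc n)). w j \<in> veronese k) \<and> (\<forall>i<betti k (Suc n). f i =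
      (\<Sum>j<betti k (Suc (Suc n)). curve_map (res_entry k (Suc (Suc n)) i j) * w j))) \<longleftrightarrow>
    (\<forall>i<betti k n. (\<Sum>j<betti k (Suc n). curve_map (res_entry k (Suc n) i j) * f j) = 0)"
proof -
  have k: "k > 0" and width: "width k m > 0" for m using assms(1) by auto
  have betti: "betti k (Suc (Suc m)) = blocks k m * width k m * k" for m
    using assms(1) by simp
  have "(\<exists>w. (\<forall>j<betti k (Suc (Suc n)). w j \<in> veronese k) \<and> (\<forall>i<betti k (Suc n). f i =
      (\<Sum>j<betti k (Suc (Suc n)). curve_map (res_entry k (Suc (Suc n)) i j) * w j))) \<longleftrightarrow>
    (\<forall>u<blocks k n. gen_combination (Suc (width k n)) f u = 0)"
    unfolding betti res_entry.simps(3) curve_map_syz_entry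
    unfolding betti.simps(2)
    by (rule syz_image[OF k width]) (use f in simp)
  also have "\<dots> \<longleftrightarrow>
      (\<forall>i<betti k n. (\<Sum>j<betti k (Suc n). curve_map (res_entry k (Suc n) i j) * f j) = 0)"
  proof (cases n)
    case 0
    have "(\<Sum>j<Suc k. curve_map (res_entry k (Suc 0) i j) * f j) = gen_combination (Suc k) f 0" for i
      unfolding sum_distrib_left by (intro sum.cong) (simp_all add: curve_map_var mult.assoc)
    then show ?thesis using 0 by simp
  next
    case (Suc m)
    have "Suc (width k (Suc m)) = k" using assms(1) by simp
    then show ?thesis
      unfolding Suc betti res_entry.simps(3) curve_map_syz_entry
      unfolding betti.simps(2) syz_kernel[OF k width] blocks.simps(2) by (simp only:)
  qed
  finally show ?thesis .
qed

lemma var_linear: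
  assumes "q \<in> {1..n}"
  shows "var q \<in> (homogeneous_part n 1 :: 'k::field mpoly set)"
    and "- var q \<in> (homogeneous_part n 1 :: 'k mpoly set)"
    and "(0 :: 'k::field mpoly) \<in> homogeneous_part n 1"
proof -
  have "Poly_Mapping.keys (var q :: 'k mpoly) = {Poly_Mapping.single q 1}"
    by (simp add: var_def)
  moreover have "Poly_Mapping.keys (- var q :: 'k mpoly) = Poly_Mapping.keys (var q :: 'k mpoly)"
    by (auto simp: in_keys_iff)
  ultimately show "var q \<in> (homogeneous_part n 1 :: 'k mpoly set)"
    "- var q \<in> (homogeneous_part n 1 :: 'k mpoly set)" "(0 :: 'k mpoly) \<in> homogeneous_part n 1"
    using assms by (simp_all add: homogeneous_part_def mpoly_ring_def mon_degree_def)
qed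

text \<open>
  Exactness at \<open>F\<^sub>0\<close>, again expressed in the Veronese ring.
\<close>

lemma generated_by_variables_iff:
  fixes F :: "'k::field poly poly"
  assumes F: "F \<in> veronese k"
  shows "(\<exists>w. (\<forall>j<k + 1. w j \<in> veronese k) \<and> F = (\<Sum>j<k + 1. gen (Suc j) * w j)) \<longleftrightarrow>
    coeff F 0 = 0"
proof
  assume "\<exists>w. (\<forall>j<k + 1. w j \<in> veronese k) \<and> F = (\<Sum>j<k + 1. gen (Suc j) * w j)"
  then obtain w where F: "F = (\<Sum>j<k + 1. gen (Suc j) * w j)" by blast
  show "coeff F 0 = 0" unfolding F coeff_sum
    by (rule sum.neutral) (simp add: coeff_mult hvar_def)
next
  assume "coeff F 0 = 0"
  moreover have "degree (coeff F (Suc j)) \<le> j * k + k" for j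
    using F[unfolded veronese_def mem_Collect_eq, rule_format, of "Suc j"] by (simp add: add.commute)
  ultimately obtain w where w: "\<forall>q. w q \<in> veronese k" "F = hvar * (\<Sum>q\<le>k. tvar ^ q * w q)"
    using veronese_decompose by blast
  have "\<forall>j<k + 1. w j \<in> veronese k" using w(1) by simp
  moreover have "F = (\<Sum>j<k + 1. gen (Suc j) * w j)"
    unfolding w(2) sum_distrib_left by (intro sum.cong) (auto simp: mult.assoc)
  ultimately show "\<exists>w. (\<forall>j<k + 1. w j \<in> veronese k) \<and> F = (\<Sum>j<k + 1. gen (Suc j) * w j)"
    by (rule exI[of _ w, OF conjI])
qed

context veronese_presentation
begin

lemma idl_variables_eq:
  assumes x: "\<And>j. j < k + 1 \<Longrightarrow> x j \<in> carrier A" "\<And>j. j < k + 1 \<Longrightarrow> \<psi> (x j) = gen (Suc j)"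
  shows "Idl (x ` {..<k + 1}) = {z \<in> carrier A. coeff (\<psi> z) 0 = 0}"
proof
  have sub: "x ` {..<k + 1} \<subseteq> carrier A" using x(1) by blast
  have "x ` {..<k + 1} \<subseteq> {z \<in> carrier A. coeff (\<psi> z) 0 = 0}"
    using x by (auto simp: coeff_mult hvar_def)
  then show "Idl (x ` {..<k + 1}) \<subseteq> {z \<in> carrier A. coeff (\<psi> z) 0 = 0}"
    by (intro genideal_minimal degree_0_ideal)
  interpret J: ideal "Idl (x ` {..<k + 1})" A by (rule genideal_ideal[OF sub])
  have mem: "x j \<in> Idl (x ` {..<k + 1})" if "j < k + 1" for j
    using genideal_self[OF sub] that by blast
  show "{z \<in> carrier A. coeff (\<psi> z) 0 = 0} \<subseteq> Idl (x ` {..<k + 1})"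
  proof safe
    fix z assume z: "z \<in> carrier A" "coeff (\<psi> z) 0 = 0"
    obtain w where w: "\<forall>j<k + 1. w j \<in> veronese k" "\<psi> z = (\<Sum>j<k + 1. gen (Suc j) * w j)"
      using generated_by_variables_iff[OF psi_closed[OF z(1)]] z(2) by blast
    have "\<forall>j\<in>{..<k + 1}. \<exists>y. y \<in> carrier A \<and> \<psi> y = w j"
      using w(1) psi_surj by blast
    from bchoice[OF this]
    obtain y where y: "\<And>j. j < k + 1 \<Longrightarrow> y j \<in> carrier A" "\<And>j. j < k + 1 \<Longrightarrow> \<psi> (y j) = w j"
      by blast
    have "(\<Oplus>j\<in>X. x j \<otimes> y j) \<in> Idl (x ` {..<k + 1})" if "finite X" "X \<subseteq> {..<k + 1}" for X
      using that
    proof (induction X rule: finite_induct)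
      case empty
      show ?case unfolding finsum_empty by (rule J.zero_closed)
    next
      case (insert j X)
      then have j: "j < k + 1" and X: "\<And>i. i \<in> X \<Longrightarrow> i < k + 1" by auto
      have "(\<Oplus>i\<in>insert j X. x i \<otimes> y i) = x j \<otimes> y j \<oplus> (\<Oplus>i\<in>X. x i \<otimes> y i)"
        using insert.hyps j X x(1) y(1) by (intro finsum_insert) auto
      moreover have "x j \<otimes> y j \<in> Idl (x ` {..<k + 1})"
        using J.I_r_closed[OF mem[OF j] y(1)[OF j]] .
      moreover have "(\<Oplus>i\<in>X. x i \<otimes> y i) \<in> Idl (x ` {..<k + 1})"
        using insert.IH insert.prems by blast
      ultimately show ?case by (simp only: J.a_closed)
    qed
    from this[OF finite_lessThan subset_refl] have "(\<Oplus>j\<in>{..<k + 1}. x j \<otimes> y j) \<in> Idl (x ` {..<k + 1})"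
      .
    moreover have "z = (\<Oplus>j\<in>{..<k + 1}. x j \<otimes> y j)"
    proof (rule psi_inj[OF z(1)])
      show "(\<Oplus>j\<in>{..<k + 1}. x j \<otimes> y j) \<in> carrier A"
        using x(1) y(1) by (intro finsum_closed) auto
      have "\<psi> (\<Oplus>j\<in>{..<k + 1}. x j \<otimes> y j) = (\<Sum>j<k + 1. \<psi> (x j \<otimes> y j))"
        using x(1) y(1) by (intro psi_finsum) auto
      also have "\<dots> = (\<Sum>j<k + 1. gen (Suc j) * w j)"
        by (intro sum.cong refl) (simp only: psi_mult x y lessThan_iff)
      finally show "\<psi> z = \<psi> (\<Oplus>j\<in>{..<k + 1}. x j \<otimes> y j)"
        by (simp only: w(2))
    qed
    ultimately show "z \<in> Idl (x ` {..<k + 1})" by (simp only:)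
  qed
qed

context
  fixes M :: "nat \<Rightarrow> nat \<Rightarrow> nat \<Rightarrow> 'a"
  assumes M_closed: "\<And>n i j. j < betti k (Suc n) \<Longrightarrow> M (Suc n) i j \<in> carrier A"
    and psi_M: "\<And>n i j. j < betti k (Suc n) \<Longrightarrow> \<psi> (M (Suc n) i j) = curve_map (res_entry k (Suc n) i j)"
begin

lemma psi_M_sum:
  "(\<Sum>j<betti k (Suc n). \<psi> (M (Suc n) i j) * w j) =
    (\<Sum>j<betti k (Suc n). curve_map (res_entry k (Suc n) i j) * w j)"
  by (intro sum.cong refl) (simp only: psi_M lessThan_iff)

lemma resolution_augmentation:
  "mat_map A (betti k 0) (betti k 1) (M 1) ` free_module A (betti k 1) =
    {v \<in> free_module A (betti k 0). coeff (\<psi> (v 0)) 0 = 0}" (is "?L = ?R")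
proof (rule Set.set_eqI)
  fix v
  have b: "betti k 1 = k + 1" by simp
  have var: "curve_map (var (Suc j)) = gen (Suc j)" for j
    by (rule curve_map_var) simp
  have sum: "(\<Sum>j<k + 1. \<psi> (M 1 i j) * w j) = (\<Sum>j<k + 1. gen (Suc j) * w j)" for i w
    using psi_M_sum[of 0 i w, unfolded res_entry.simps(2) var, folded One_nat_def, unfolded b] .
  have "v \<in> ?L \<longleftrightarrow> v \<in> free_module A 1 \<and> (\<exists>w. (\<forall>j<k + 1. w j \<in> veronese k) \<and>
      (\<forall>i<1. \<psi> (v i) = (\<Sum>j<k + 1. \<psi> (M 1 i j) * w j)))"
    unfolding betti.simps(1) b
    by (rule mat_map_image_iff) (use M_closed[of _ 0, folded One_nat_def, unfolded b] in blast)
  then have "v \<in> ?L \<longleftrightarrow> v \<in> free_module A 1 \<and> (\<exists>w. (\<forall>j<k + 1. w j \<in> veronese k) \<and>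
      (\<forall>i<1. \<psi> (v i) = (\<Sum>j<k + 1. gen (Suc j) * w j)))"
    unfolding sum .
  also have "\<dots> \<longleftrightarrow> v \<in> free_module A 1 \<and> coeff (\<psi> (v 0)) 0 = 0"
  proof (cases "v \<in> free_module A 1")
    case True
    then have "v 0 \<in> carrier A" by (auto simp: free_module_def)
    then show ?thesis using generated_by_variables_iff[of "\<psi> (v 0)" k] by auto
  qed simp
  finally show "v \<in> ?L \<longleftrightarrow> v \<in> ?R" by simp
qed

lemma resolution_exact:
  assumes "k \<ge> 2"
  shows "mat_map A (betti k (Suc n)) (betti k (Suc (Suc n))) (M (Suc (Suc n))) `
      free_module A (betti k (Suc (Suc n))) =
    {v \<in> free_module A (betti k (Suc n)).
      mat_map A (betti k n) (betti k (Suc n)) (M (Suc n)) v = (\<lambda>i\<in>{..<betti k n}. \<zero>)}"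
    (is "?L = ?R")
proof (rule Set.set_eqI)
  fix v
  let ?b = "betti k (Suc n)" and ?c = "betti k (Suc (Suc n))"
  have image: "v \<in> ?L \<longleftrightarrow> v \<in> free_module A ?b \<and> (\<exists>w. (\<forall>j<?c. w j \<in> veronese k) \<and>
      (\<forall>i<?b. \<psi> (v i) = (\<Sum>j<?c. \<psi> (M (Suc (Suc n)) i j) * w j)))"
    by (rule mat_map_image_iff) (rule M_closed)
  show "v \<in> ?L \<longleftrightarrow> v \<in> ?R"
  proof (cases "v \<in> free_module A ?b")
    case True
    have v: "\<forall>i<?b. \<psi> (v i) \<in> veronese k"
      by (intro allI impI psi_closed PiE_mem[OF True[unfolded free_module_def]]) (simp only: lessThan_iff)
    have "v \<in> ?L \<longleftrightarrow> (\<forall>i<betti k n. (\<Sum>j<?b. \<psi> (M (Suc n) i j) * \<psi> (v j)) = 0)"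
      using True res_exact[OF assms v] unfolding image psi_M_sum by (simp only: simp_thms)
    also have "\<dots> \<longleftrightarrow> mat_map A (betti k n) ?b (M (Suc n)) v = (\<lambda>i\<in>{..<betti k n}. \<zero>)"
      by (rule mat_map_eq_zero_iff[symmetric]) (rule M_closed True, assumption?)+
    finally show ?thesis using True by (simp only: mem_Collect_eq simp_thms)
  next
    case False
    then show ?thesis unfolding image by (simp only: mem_Collect_eq simp_thms)
  qed
qed

end

end

text \<open>
  The isomorphism induced by the parametrisation sends the class of \<open>f\<close> to the image of \<open>f\<close>.
\<close>

lemma the_elem_curve_map_coset:
  fixes f :: "'k::field mpoly"
  assumes "f \<in> carrier (mpoly_ring n)"
  shows "the_elem (curve_map ` (a_kernel (mpoly_ring n) (veronese_ring k) curve_map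
    +>\<^bsub>mpoly_ring n\<^esub> f)) = curve_map f"
proof -
  let ?I = "a_kernel (mpoly_ring n) (veronese_ring k) curve_map :: 'k mpoly set"
  have I: "?I = {h \<in> carrier (mpoly_ring n). curve_map h = 0}"
    by (simp add: a_kernel_def' veronese_ring_def)
  have coset: "?I +>\<^bsub>mpoly_ring n\<^esub> f = (\<lambda>h. h + f) ` ?I"
    unfolding a_r_coset_def' by (auto simp: mpoly_ring_def)
  have "curve_map (h + f) = curve_map f" if "h \<in> ?I" for h
    using that by (simp add: I curve_map_add)
  moreover have "0 \<in> ?I" unfolding I by (simp add: mpoly_ring_def)
  ultimately have "curve_map ` (?I +>\<^bsub>mpoly_ring n\<^esub> f) = {curve_map f}"
    unfolding coset image_image by (auto simp del: curve_map_0)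
  then show ?thesis by simp
qed


text \<open>
  The matrices of classes of \<open>res_entry\<close>, with all generators of the \<open>n\<close>-th module in degree \<open>n\<close>,
  are a linear minimal resolution: exactness is carried over from the Veronese ring by
  \<open>resolution_augmentation\<close> and \<open>resolution_exact\<close>, and each entry is zero or a variable up to sign.
\<close>

theorem koszul_rational_normal_curve:
  fixes I :: "'k::field mpoly set"
  assumes "k \<ge> 2" and I: "I = a_kernel (mpoly_ring (k + 1)) (veronese_ring k) curve_map"
  shows "koszul (k + 1) I"
proof -
  let ?P = "mpoly_ring (k + 1) :: 'k mpoly ring"
  let ?A = "quot_ring (k + 1) I"
  define cls :: "'k mpoly \<Rightarrow> 'k mpoly set" where "cls f = I +>\<^bsub>?P\<^esub> f" for f
  define \<psi> :: "'k mpoly set \<Rightarrow> 'k poly poly" where "\<psi> C = the_elem (curve_map ` C)" for C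
  have ideal: "ideal I ?P" unfolding I by (rule ring_hom_ring.kernel_is_ideal[OF ring_hom_curve_map])
  have surj: "curve_map ` carrier ?P = carrier (veronese_ring k)"
    using curve_map_in_veronese[of _ k] curve_map_surj[of _ k]
    by (auto simp: veronese_ring_def image_iff)
  have iso: "\<psi> \<in> ring_iso ?A (veronese_ring k)"
    unfolding \<psi>_def quot_ring_def I
    by (rule ring_hom_ring.FactRing_iso_set[OF ring_hom_curve_map surj])
  have cring: "cring ?A"
    unfolding quot_ring_def by (rule ideal.quotient_is_cring[OF ideal cring_mpoly_ring])
  have A: "veronese_presentation ?A k \<psi>"
    by (intro veronese_presentation.intro veronese_presentation_axioms.intro cring iso)
  have cls_closed: "cls f \<in> carrier ?A" if "f \<in> carrier ?P" for f
    using that by (auto simp: cls_def quot_ring_def FactRing_def A_RCOSETS_def')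
  have psi_cls: "\<psi> (cls f) = curve_map f" if "f \<in> carrier ?P" for f
    unfolding \<psi>_def cls_def I by (rule the_elem_curve_map_coset[OF that])
  have var_closed: "var q \<in> carrier ?P" if "q \<in> {1..k + 1}" for q
    using var_linear(1)[OF that, where 'k = 'k] by (simp add: homogeneous_part_def)

  define M where "M n i j = cls (res_entry k n i j)" for n i j
  have lin: "res_entry k (Suc n) i j \<in> (homogeneous_part (k + 1) 1 :: 'k mpoly set)"
    if j: "j < betti k (Suc n)" for n i j
  proof -
    have "k > 0" using assms(1) by simp
    from this j obtain q where q: "q \<in> {1..k + 1}"
      "res_entry k (Suc n) i j \<in> {var q, - var q, 0 :: 'k mpoly}"
      by (rule res_entry_cases)
    show ?thesis using q(2) by (elim insertE) (simp_all only: var_linear[OF q(1)] empty_iff)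
  qed
  have res_closed: "res_entry k (Suc n) i j \<in> carrier ?P" if "j < betti k (Suc n)" for n i j
    using lin[OF that] by (simp add: homogeneous_part_def)
  have M_closed: "M (Suc n) i j \<in> carrier ?A" if "j < betti k (Suc n)" for n i j
    unfolding M_def by (rule cls_closed[OF res_closed[OF that]])
  have psi_M: "\<psi> (M (Suc n) i j) = curve_map (res_entry k (Suc n) i j)"
    if "j < betti k (Suc n)" for n i j
    unfolding M_def by (rule psi_cls[OF res_closed[OF that]])

  have max_ideal: "quot_max_ideal (k + 1) I = {z \<in> carrier ?A. coeff (\<psi> z) 0 = 0}"
  proof -
    have v: "var (Suc j) \<in> carrier ?P" if "j < k + 1" for j
      using that by (intro var_closed) auto
    have "(\<lambda>i. I +>\<^bsub>?P\<^esub> var i) ` {1..k + 1} = (\<lambda>j. cls (var (Suc j))) ` {..<k + 1}"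
    proof -
      have "{1..k + 1} = Suc ` {..<k + 1}"
        by (simp add: image_Suc_lessThan)
      then show ?thesis by (simp only: image_image cls_def)
    qed
    moreover have "Idl\<^bsub>?A\<^esub> ((\<lambda>j. cls (var (Suc j))) ` {..<k + 1}) = {z \<in> carrier ?A. coeff (\<psi> z) 0 = 0}"
    proof (rule veronese_presentation.idl_variables_eq[OF A])
      fix j assume j: "j < k + 1"
      show "cls (var (Suc j)) \<in> carrier ?A" by (rule cls_closed[OF v[OF j]])
      show "\<psi> (cls (var (Suc j))) = gen (Suc j)"
        unfolding psi_cls[OF v[OF j]] by (rule curve_map_var) simp
    qed
    ultimately show ?thesis unfolding quot_max_ideal_def by (simp only:)
  qed
  have M_max: "M (Suc n) i j \<in> quot_max_ideal (k + 1) I" if "j < betti k (Suc n)" for n i j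
  proof -
    have "homogeneous_component 0 (res_entry k (Suc n) i j :: 'k mpoly) = 0"
      unfolding homogeneous_component_def
    proof (rule sum.neutral, rule ballI)
      fix m assume m: "m \<in> {m \<in> Poly_Mapping.keys (res_entry k (Suc n) i j :: 'k mpoly). mon_degree m = 0}"
      then have "int (mon_degree m) = 1"
        using lin[OF that, of i] unfolding homogeneous_part_def by blast
      with m show "Poly_Mapping.single m
          (Poly_Mapping.lookup (res_entry k (Suc n) i j :: 'k mpoly) m) = 0"
        by simp
    qed
    then have "coeff (curve_map (res_entry k (Suc n) i j :: 'k mpoly)) 0 = 0"
      using curve_map_homogeneous_component[of 0 "res_entry k (Suc n) i j :: 'k mpoly"] by simp
    then show ?thesis
      unfolding max_ideal mem_Collect_eq psi_M[OF that] using M_closed[OF that] by blast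
  qed
  have M_lin: "M (Suc n) i j \<in> quot_part (k + 1) I 1" if "j < betti k (Suc n)" for n i j
    unfolding M_def quot_part_def cls_def using lin[OF that] by blast

  have augmentation: "mat_map ?A (betti k 0) (betti k 1) (M 1) ` free_module ?A (betti k 1) =
      {v \<in> free_module ?A (betti k 0). coeff (\<psi> (v 0)) 0 = 0}"
    by (rule veronese_presentation.resolution_augmentation[OF A]; (rule M_closed psi_M)?; assumption?)
  have exact_0: "mat_map ?A (betti k 0) (betti k 1) (M 1) ` free_module ?A (betti k 1) =
      {v \<in> free_module ?A (betti k 0). v 0 \<in> quot_max_ideal (k + 1) I}"
  proof -
    have "v 0 \<in> carrier ?A" if "v \<in> free_module ?A (betti k 0)" for v
      using that by (auto simp: free_module_def)
    then show ?thesis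
      unfolding max_ideal augmentation by blast
  qed
  have "graded_free_resolution (k + 1) I (betti k) (\<lambda>n i. int n) M"
    unfolding graded_free_resolution_def Let_def
  proof (intro conjI allI impI)
    show "M (Suc n) i j \<in> quot_part (k + 1) I (int (Suc n) - int n)" if "j < betti k (Suc n)" for n i j
      using M_lin[OF that] by simp
    show "mat_map ?A (betti k (Suc n)) (betti k (Suc (Suc n))) (M (Suc (Suc n))) `
        free_module ?A (betti k (Suc (Suc n))) =
      {v \<in> free_module ?A (betti k (Suc n)).
        mat_map ?A (betti k n) (betti k (Suc n)) (M (Suc n)) v = (\<lambda>i\<in>{..<betti k n}. \<zero>\<^bsub>?A\<^esub>)}" for n
      by (rule veronese_presentation.resolution_exact[OF A]; (rule M_closed psi_M assms(1))?; assumption?)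
  qed (rule exact_0 | simp)+
  then have "minimal_resolution (k + 1) I (betti k) (\<lambda>n i. int n) M"
    unfolding minimal_resolution_def using M_max by blast
  moreover have "linear_differentials (k + 1) I (betti k) M"
    unfolding linear_differentials_def using M_lin by blast
  moreover have "I \<noteq> carrier ?P"
  proof -
    have "1 \<notin> I" "1 \<in> carrier ?P"
      by (simp_all add: I a_kernel_def' veronese_ring_def mpoly_ring_def)
    then show ?thesis by blast
  qed
  moreover have "graded_ideal (k + 1) I" unfolding I by (rule graded_ideal_kernel)
  ultimately show ?thesis unfolding koszul_def by blast
qed

theorem theorem5p7:
  fixes a d :: "nat ^ 2" and k :: nat
  assumes "k \<ge> 2"
    and "lin_indep_over_Q a d"
    and "minimal_generating_set (S_gens a d k) (S_semigroup a d k)"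
  shows "koszul (k + 1) (I_S a d k :: 'k::field mpoly set)"
  using assms(1) I_S_eq_kernel[OF assms(2)] by (rule koszul_rational_normal_curve)

end
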